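(* Let $\{A_i\mid i\in I\}$ be a family of groups, let $c\ge 1$ be an integer, and let $\mathcal V$ be a variety of groups defined by a set of laws $V$. Let $A=\prod^{*}_{i\in I}A_i$ be the free product, with Cartesian subgroup $[A_i^A]$, and put $H_v=V(A)\cap[A_i^A]$ and $H_c=\gamma_{c+1}(A)\cap[A_i^A]$. Let $G=\mathcal V\prod_{i\in I}A_i=A/H_v$ be the verbal product of the $A_i$ with respect to $\mathcal V$. (i) If $\mathcal N_c\subseteq\mathcal V$, then $\prod^{\times}_{i\in I}\mathcal N_cM(A_i)\times H_v/[H_v,\,_cA]$ is a homomorphic image of $\mathcal N_cM(G)$; and if $G$ is finite, then this group $\prod^{\times}_{i\in I}\mathcal N_cM(A_i)\times H_v/[H_v,\,_cA]$ is isomorphic to a subgroup of $\mathcal N_cM(G)$. (ii) If $\mathcal V\subseteq\mathcal N_c$, then $\prod^{\times}_{i\in I}\mathcal N_cM(A_i)\times H_c/[H_v,\,_cA]$ is a homomorphic image of $\mathcal N_cM(G)$; and if $G$ is finite, then this group $\prod^{\times}_{i\in I}\mathcal N_cM(A_i)\times H_c/[H_v,\,_cA]$ is isomorphic to a subgroup of $\mathcal N_cM(G)$.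
   Context: $I$ is an ordered index set. $\mathcal N_c$ is the variety of nilpotent groups of class at most $c$. For a group $G$ with free presentation $G\cong F/R$ ($F$ free), the $c$-nilpotent multiplier is $\mathcal N_cM(G)=(R\cap\gamma_{c+1}(F))/[R,\,_cF]$, which is independent of the presentation up to isomorphism. Here $\gamma_k$ denotes the $k$-th term of the lower central series ($\gamma_1(F)=F$), and $[X,\,_cF]=[X,F,\dots,F]$ is the left-normed commutator subgroup with $c$ copies of $F$. For a group $X$, $V(X)$ is the verbal subgroup of $X$ determined by the laws $V$. $\prod^{*}$ denotes the free product and $\prod^{\times}$ the (restricted) direct product. The Cartesian subgroup $[A_i^A]$ of the free product $A=\prod^{*}_{i\in I}A_i$ is the kernel of the natural map from $A$ onto the direct product of the $A_i$, i.e. the normal closure in $A$ of $\langle[A_i,A_j]\mid i,j\in I,\ i\ne j\rangle$. The verbal product of $\{A_i\}_{i\in I}$ associated with $\mathcal V$ is $\mathcal V\prod_{i\in I}A_i=A/(V(A)\cap[A_i^A])$. *)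

theory Defs
  imports "HOL-Algebra.Product_Groups"
begin

section \<open>Free groups and free products\<close>

text \<open>
  The least congruence on the monoid of words over the alphabet \<open>L\<close> that contains the
  pairs of words in \<open>r\<close>.
\<close>

inductive_set word_cong :: "'l set \<Rightarrow> ('l list \<times> 'l list) set \<Rightarrow> ('l list \<times> 'l list) set"
  for L r where
  rel: "\<lbrakk>(u, v) \<in> r; u \<in> lists L; v \<in> lists L; p \<in> lists L; q \<in> lists L\<rbrakk>
          \<Longrightarrow> (p @ u @ q, p @ v @ q) \<in> word_cong L r"
| refl: "w \<in> lists L \<Longrightarrow> (w, w) \<in> word_cong L r"
| sym: "(u, v) \<in> word_cong L r \<Longrightarrow> (v, u) \<in> word_cong L r"
| trans: "\<lbrakk>(u, v) \<in> word_cong L r; (v, w) \<in> word_cong L r\<rbrakk> \<Longrightarrow> (u, w) \<in> word_cong L r"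

definition presented_monoid :: "'l set \<Rightarrow> ('l list \<times> 'l list) set \<Rightarrow> 'l list set monoid" where
  "presented_monoid L r =
     \<lparr>carrier = lists L // word_cong L r,
      mult = (\<lambda>P Q. \<Union>u\<in>P. \<Union>v\<in>Q. word_cong L r `` {u @ v}),
      one = word_cong L r `` {[]}\<rparr>"

text \<open>The letter \<open>(x, True)\<close> stands for \<open>x\<close> and \<open>(x, False)\<close> for its inverse.\<close>

definition free_group :: "'x set \<Rightarrow> ('x \<times> bool) list set monoid" where
  "free_group X =
     presented_monoid (X \<times> UNIV) {([(x, b), (x, \<not> b)], []) | x b. x \<in> X}"

text \<open>The letter \<open>(i, a)\<close> stands for the element \<open>a\<close> of the factor \<open>A i\<close>.\<close>

definition free_product ::
    "'i set \<Rightarrow> ('i \<Rightarrow> ('a, 'm) monoid_scheme) \<Rightarrow> ('i \<times> 'a) list set monoid" where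
  "free_product I A =
     presented_monoid (SIGMA i:I. carrier (A i))
       ({([(i, \<one>\<^bsub>A i\<^esub>)], []) | i. i \<in> I} \<union>
        {([(i, a), (i, b)], [(i, a \<otimes>\<^bsub>A i\<^esub> b)]) | i a b.
           i \<in> I \<and> a \<in> carrier (A i) \<and> b \<in> carrier (A i)})"

text \<open>The value in \<open>G\<close> of a word whose letters are interpreted by \<open>f\<close>.\<close>

definition word_value :: "('g, 'm) monoid_scheme \<Rightarrow> ('l \<Rightarrow> 'g) \<Rightarrow> 'l list \<Rightarrow> 'g" where
  "word_value G f w = foldr (\<lambda>l x. f l \<otimes>\<^bsub>G\<^esub> x) w \<one>\<^bsub>G\<^esub>"

text \<open>
  The homomorphism from the free product to the restricted direct product \<open>sum_group\<close> that maps every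
  factor identically onto itself.  All words in one congruence class have the same value.
\<close>

definition natural_map ::
    "'i set \<Rightarrow> ('i \<Rightarrow> ('a, 'm) monoid_scheme) \<Rightarrow> ('i \<times> 'a) list set \<Rightarrow> 'i \<Rightarrow> 'a" where
  "natural_map I A P =
     the_elem (word_value (sum_group I A)
                 (\<lambda>(i, a). \<lambda>j\<in>I. if j = i then a else \<one>\<^bsub>A j\<^esub>) ` P)"

definition cartesian_subgroup ::
    "'i set \<Rightarrow> ('i \<Rightarrow> ('a, 'm) monoid_scheme) \<Rightarrow> ('i \<times> 'a) list set set" where
  "cartesian_subgroup I A = kernel (free_product I A) (sum_group I A) (natural_map I A)"


section \<open>Commutator subgroups and nilpotent multipliers\<close>

definition commutator_subgroup :: "('g, 'm) monoid_scheme \<Rightarrow> 'g set \<Rightarrow> 'g set \<Rightarrow> 'g set" where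
  "commutator_subgroup G H K =
     generate G {inv\<^bsub>G\<^esub> h \<otimes>\<^bsub>G\<^esub> inv\<^bsub>G\<^esub> k \<otimes>\<^bsub>G\<^esub> h \<otimes>\<^bsub>G\<^esub> k | h k. h \<in> H \<and> k \<in> K}"

text \<open>\<open>iterated_commutator G H n\<close> is \<open>[H, G, \<dots>, G]\<close>, left-normed, with \<open>n\<close> copies of \<open>G\<close>.\<close>

primrec iterated_commutator :: "('g, 'm) monoid_scheme \<Rightarrow> 'g set \<Rightarrow> nat \<Rightarrow> 'g set" where
  "iterated_commutator G H 0 = H"
| "iterated_commutator G H (Suc n) = commutator_subgroup G (iterated_commutator G H n) (carrier G)"

text \<open>Indexed from 1: \<open>lower_central G 1 = carrier G\<close>.\<close>

definition lower_central :: "('g, 'm) monoid_scheme \<Rightarrow> nat \<Rightarrow> 'g set" where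
  "lower_central G k = iterated_commutator G (carrier G) (k - 1)"

text \<open>
  \<open>F\<close> is free and \<open>G\<close> is isomorphic to \<open>F/R\<close>.  A free basis of \<open>F\<close> is a subset of its carrier,
  so it is no restriction that \<open>X\<close> consists of elements of the type underlying \<open>F\<close>.
\<close>

definition free_presentation ::
    "('f, 'k) monoid_scheme \<Rightarrow> 'f set \<Rightarrow> ('g, 'm) monoid_scheme \<Rightarrow> bool" where
  "free_presentation F R G \<longleftrightarrow>
     group F \<and> (\<exists>X :: 'f set. F \<cong> free_group X) \<and> R \<lhd> F \<and> F Mod R \<cong> G"

definition nilpotent_multiplier :: "nat \<Rightarrow> ('f, 'k) monoid_scheme \<Rightarrow> 'f set \<Rightarrow> 'f set monoid" where
  "nilpotent_multiplier c F R =
     (F\<lparr>carrier := R \<inter> lower_central F (c + 1)\<rparr>) Mod iterated_commutator F R c"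


section \<open>Varieties and verbal products\<close>

text \<open>
  A law is a word in the variables \<open>0, 1, 2, \<dots>\<close> and their inverses, with letters as in
  \<open>free_group\<close>.
\<close>

type_synonym law = "(nat \<times> bool) list"

definition law_value :: "('g, 'm) monoid_scheme \<Rightarrow> (nat \<Rightarrow> 'g) \<Rightarrow> law \<Rightarrow> 'g" where
  "law_value G x = word_value G (\<lambda>(n, b). if b then x n else inv\<^bsub>G\<^esub> x n)"

definition verbal_subgroup :: "('g, 'm) monoid_scheme \<Rightarrow> law set \<Rightarrow> 'g set" where
  "verbal_subgroup G V = generate G {law_value G x w | x w. range x \<subseteq> carrier G \<and> w \<in> V}"

text \<open>
  A formula cannot quantify over the groups of all types.  Since a law involves only finitely
  many variables and finitely generated groups are countable, one variety is contained in
  another if and only if this holds for their members with carrier in \<open>nat\<close>.  Inclusions of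
  varieties are therefore stated at the type \<open>nat monoid set\<close>; the inclusion for groups of
  all types implies the inclusion at this type.
\<close>

definition variety :: "law set \<Rightarrow> 'g monoid set" where
  "variety V =
     {G. group G \<and> (\<forall>w\<in>V. \<forall>x. range x \<subseteq> carrier G \<longrightarrow> law_value G x w = \<one>\<^bsub>G\<^esub>)}"

definition nilpotent_variety :: "nat \<Rightarrow> 'g monoid set" where
  "nilpotent_variety c = {G. group G \<and> lower_central G (c + 1) = {\<one>\<^bsub>G\<^esub>}}"

definition verbal_product ::
    "law set \<Rightarrow> 'i set \<Rightarrow> ('i \<Rightarrow> ('a, 'm) monoid_scheme) \<Rightarrow> ('i \<times> 'a) list set set monoid" where
  "verbal_product V I A =
     free_product I A Mod (verbal_subgroup (free_product I A) V \<inter> cartesian_subgroup I A)"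

end

theory Submission
  imports Defs "HOL-Algebra.Multiplicative_Group" "HOL-Computational_Algebra.Primes"
    "HOL-Library.Countable_Set"
begin

text \<open>
  Write \<open>\<gamma>\<^sub>k\<close> for the terms of the lower central series, so that
  \<open>iterated_commutator G (carrier G) c\<close> is \<open>\<gamma>\<^bsub>c+1\<^esub>(G)\<close>, and let \<open>P\<close> be the free product of the \<open>A i\<close>.

  The two cases are one.  If nilpotent groups of class \<open>c\<close> satisfy \<open>V\<close>, then \<open>V(P)\<close> lies in
  \<open>\<gamma>\<^bsub>c+1\<^esub>(P)\<close>; if \<open>V\<close> forces nilpotency of class \<open>c\<close>, the inclusion is reversed.  Either way the
  second factor of the product in question is \<open>(H\<^sub>v \<inter> \<gamma>\<^bsub>c+1\<^esub>(P)) / [H\<^sub>v, P, \<dots>, P]\<close>, which is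
  the expression that defines a multiplier, formed in \<open>P\<close> instead of a free group.  The
  inclusions of verbal subgroups follow from the inclusions of varieties of countable
  groups, because a law involves countably many elements, as does membership in \<open>\<gamma>\<^bsub>c+1\<^esub>\<close>
  (\<open>verbal_subset_lower_central\<close>, \<open>lower_central_subset_verbal\<close>).

  The epimorphism exists for \<open>P/H\<close> with any normal subgroup \<open>H\<close> of \<open>P\<close> inside the Cartesian subgroup
  (\<open>nilpotent_multiplier_epi\<close>).  Let \<open>F/R\<close> be a free presentation of \<open>P/H\<close>.  Projectivity of \<open>F\<close> lifts
  \<open>F \<rightarrow> P/H\<close> to \<open>\<mu> : F \<rightarrow> P\<close>, and lifts \<open>F \<rightarrow> P \<rightarrow> \<Prod> A i\<close> to \<open>\<kappa> : F \<rightarrow> \<Prod> E i\<close>.  These two maps induce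
  the homomorphism on multipliers.  For surjectivity, \<open>P = \<mu>(F) H\<close> gives
  \<open>\<gamma>\<^bsub>c+1\<^esub>(P) = \<mu>(\<gamma>\<^bsub>c+1\<^esub>(F)) [H, P, \<dots>, P]\<close>, which takes care of the second factor, and lifts
  \<open>\<theta> i : E i \<rightarrow> F\<close> of \<open>E i \<rightarrow> A i \<rightarrow> P/H\<close> take care of the first.  All comparisons between these lifts rest
  on one principle: homomorphisms that are congruent modulo a normal subgroup \<open>N\<close> of the target \<open>Y\<close>
  are congruent modulo \<open>[N, Y, \<dots>, Y]\<close> on \<open>\<gamma>\<^bsub>c+1\<^esub>\<close> (\<open>congruent_homs_on_lower_central\<close>), a consequence
  of \<open>[N, \<gamma>\<^sub>k(Y)] \<subseteq> [N, Y, \<dots>, Y]\<close> with \<open>k\<close> copies of \<open>Y\<close> on the right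
  (\<open>commutator_lower_central_mem\<close>).

  If \<open>P/H\<^sub>v\<close> is finite, then its multiplier is finite by a theorem of Baer (\<open>Baer_finite\<close>) and it is
  abelian, and a homomorphic image of a finite abelian group is isomorphic to one of its subgroups
  (\<open>epi_image_iso_subgroup\<close>).
\<close>

section \<open>Commutator calculus\<close>

definition commutator :: "('g, 'm) monoid_scheme \<Rightarrow> 'g \<Rightarrow> 'g \<Rightarrow> 'g" where
  "commutator G x y = inv\<^bsub>G\<^esub> x \<otimes>\<^bsub>G\<^esub> inv\<^bsub>G\<^esub> y \<otimes>\<^bsub>G\<^esub> x \<otimes>\<^bsub>G\<^esub> y"

lemma commutator_subgroup_eq:
  "commutator_subgroup G H K = generate G {commutator G h k | h k. h \<in> H \<and> k \<in> K}"
  by (simp add: commutator_subgroup_def commutator_def)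

context group
begin

lemma commutator_closed [simp, intro]:
  "\<lbrakk>x \<in> carrier G; y \<in> carrier G\<rbrakk> \<Longrightarrow> commutator G x y \<in> carrier G"
  by (simp add: commutator_def)

lemma inv_cancel_left: "\<lbrakk>x \<in> carrier G; y \<in> carrier G\<rbrakk> \<Longrightarrow> inv x \<otimes> (x \<otimes> y) = y"
  by (simp flip: m_assoc)

lemma cancel_inv_left: "\<lbrakk>x \<in> carrier G; y \<in> carrier G\<rbrakk> \<Longrightarrow> x \<otimes> (inv x \<otimes> y) = y"
  by (simp flip: m_assoc)

lemmas word_simps = m_assoc inv_mult_group inv_cancel_left cancel_inv_left

lemma inv_commutator:
  "\<lbrakk>x \<in> carrier G; y \<in> carrier G\<rbrakk> \<Longrightarrow> inv (commutator G x y) = commutator G y x"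
  by (simp add: commutator_def word_simps)

lemma commutator_mult_right:
  "\<lbrakk>x \<in> carrier G; y \<in> carrier G; z \<in> carrier G\<rbrakk> \<Longrightarrow>
     commutator G x (y \<otimes> z) = commutator G x z \<otimes> (inv z \<otimes> commutator G x y \<otimes> z)"
  by (simp add: commutator_def word_simps)

lemma commutator_inv_right:
  "\<lbrakk>x \<in> carrier G; y \<in> carrier G\<rbrakk> \<Longrightarrow>
     commutator G x (inv y) = inv (y \<otimes> commutator G x y \<otimes> inv y)"
  by (simp add: commutator_def word_simps)

lemma conjugate_commutator:
  "\<lbrakk>x \<in> carrier G; y \<in> carrier G; z \<in> carrier G\<rbrakk> \<Longrightarrow>
     z \<otimes> commutator G x y \<otimes> inv z = commutator G (z \<otimes> x \<otimes> inv z) (z \<otimes> y \<otimes> inv z)"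
  by (simp add: commutator_def word_simps)

text \<open>
  The source of the three subgroups lemma: if two of the three factors lie in a normal subgroup,
  so does the third.
\<close>

lemma Hall_Witt:
  assumes "x \<in> carrier G" "y \<in> carrier G" "z \<in> carrier G"
  shows "(inv y \<otimes> commutator G (commutator G x (inv y)) z \<otimes> y)
      \<otimes> (inv z \<otimes> commutator G (commutator G y (inv z)) x \<otimes> z)
      \<otimes> (inv x \<otimes> commutator G (commutator G z (inv x)) y \<otimes> x) = \<one>"
  using assms by (simp add: commutator_def word_simps)

lemma commutator_eq_one_iff:
  assumes "x \<in> carrier G" "y \<in> carrier G"
  shows "commutator G x y = \<one> \<longleftrightarrow> x \<otimes> y = y \<otimes> x"
proof -
  have "commutator G x y = inv (y \<otimes> x) \<otimes> (x \<otimes> y)"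
    using assms by (simp add: commutator_def word_simps)
  then show ?thesis
    using assms by (metis inv_closed inv_equality inv_inv l_inv m_closed)
qed

lemma subgroup_commutator_subgroup:
  assumes "H \<subseteq> carrier G" "K \<subseteq> carrier G"
  shows "subgroup (commutator_subgroup G H K) G"
  unfolding commutator_subgroup_eq using assms by (intro generate_is_subgroup) auto

lemma commutator_mem: "\<lbrakk>h \<in> H; k \<in> K\<rbrakk> \<Longrightarrow> commutator G h k \<in> commutator_subgroup G H K"
  unfolding commutator_subgroup_eq by (rule generate.incl) blast

lemma commutator_subgroup_least:
  assumes "subgroup L G" "\<And>h k. \<lbrakk>h \<in> H; k \<in> K\<rbrakk> \<Longrightarrow> commutator G h k \<in> L"
  shows "commutator_subgroup G H K \<subseteq> L"
  unfolding commutator_subgroup_eq using assms by (intro generate_subgroup_incl) auto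

lemma normal_conj: "\<lbrakk>N \<lhd> G; n \<in> N; x \<in> carrier G\<rbrakk> \<Longrightarrow> x \<otimes> n \<otimes> inv x \<in> N"
  by (simp add: normal.inv_op_closed2)

lemma normal_conj': "\<lbrakk>N \<lhd> G; n \<in> N; x \<in> carrier G\<rbrakk> \<Longrightarrow> inv x \<otimes> n \<otimes> x \<in> N"
  by (simp add: normal.inv_op_closed1)

lemma normal_subset: "N \<lhd> G \<Longrightarrow> N \<subseteq> carrier G"
  by (simp add: normal_imp_subgroup subgroup.subset)

lemma normal_commutator_subgroup:
  assumes "H \<lhd> G" "K \<lhd> G"
  shows "commutator_subgroup G H K \<lhd> G"
  unfolding commutator_subgroup_eq
proof (rule normal_generateI)
  show "{commutator G h k | h k. h \<in> H \<and> k \<in> K} \<subseteq> carrier G"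
    using assms[THEN normal_subset] by auto
next
  fix u g assume "u \<in> {commutator G h k | h k. h \<in> H \<and> k \<in> K}" and g: "g \<in> carrier G"
  then obtain h k where u: "u = commutator G h k" and hk: "h \<in> H" "k \<in> K" by blast
  then have "g \<otimes> u \<otimes> inv g = commutator G (g \<otimes> h \<otimes> inv g) (g \<otimes> k \<otimes> inv g)"
    using assms[THEN normal_subset] g by (simp add: conjugate_commutator subset_iff)
  then show "g \<otimes> u \<otimes> inv g \<in> {commutator G h k | h k. h \<in> H \<and> k \<in> K}"
    using normal_conj[OF assms(1) hk(1) g] normal_conj[OF assms(2) hk(2) g] by blast
qed

lemma normal_commutator_mem:
  assumes "N \<lhd> G" "n \<in> N" "x \<in> carrier G"
  shows "commutator G n x \<in> N"
proof -
  interpret N: normal N G by fact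
  have "commutator G n x = inv n \<otimes> (inv x \<otimes> n \<otimes> x)"
    using assms N.subset by (auto simp: commutator_def word_simps)
  then show ?thesis
    using assms by (simp add: N.inv_op_closed1)
qed

lemma normal_iterated_commutator: "N \<lhd> G \<Longrightarrow> iterated_commutator G N n \<lhd> G"
  by (induction n) (auto intro: normal_commutator_subgroup normal_self)

lemma iterated_commutator_Suc_subset:
  assumes "N \<lhd> G"
  shows "iterated_commutator G N (Suc n) \<subseteq> iterated_commutator G N n"
  using normal_iterated_commutator[OF assms]
  by (simp add: commutator_subgroup_least normal_commutator_mem normal_imp_subgroup)

lemma iterated_commutator_subset:
  assumes "N \<lhd> G"
  shows "iterated_commutator G N n \<subseteq> N"
  using iterated_commutator_Suc_subset[OF assms]
  by (induction n) (simp, blast)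

text \<open>
  Peeling off the innermost commutator instead of the outermost one; this lets an induction on the
  length pass from \<open>N\<close> to \<open>[N, G]\<close>.
\<close>

lemma iterated_commutator_Suc':
  "iterated_commutator G (commutator_subgroup G N (carrier G)) n = iterated_commutator G N (Suc n)"
  by (induction n) auto

lemma commutator_subgroup_mono:
  "\<lbrakk>H \<subseteq> H'; K \<subseteq> K'; H' \<subseteq> carrier G; K' \<subseteq> carrier G\<rbrakk> \<Longrightarrow>
     commutator_subgroup G H K \<subseteq> commutator_subgroup G H' K'"
  by (intro commutator_subgroup_least subgroup_commutator_subgroup) (auto intro: commutator_mem)

lemma iterated_commutator_mono:
  assumes "H \<subseteq> N" "N \<lhd> G"
  shows "iterated_commutator G H n \<subseteq> iterated_commutator G N n"
  using assms
  by (induction n) (simp_all add: commutator_subgroup_mono normal_subset normal_iterated_commutator)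

text \<open>
  These are the elements that centralize \<open>N\<close> modulo \<open>K\<close>.  That they form a subgroup reduces
  statements about \<open>[N, [A, B]]\<close> to the generators of \<open>[A, B]\<close>.
\<close>

lemma subgroup_centralizing_mod:
  assumes "N \<subseteq> carrier G" "K \<lhd> G"
  shows "subgroup {x \<in> carrier G. \<forall>n\<in>N. commutator G n x \<in> K} G"
proof -
  interpret K: normal K G by fact
  show ?thesis
  proof (rule subgroupI)
    have "commutator G n \<one> = \<one>" if "n \<in> N" for n
      using that assms(1) by (auto simp: commutator_def)
    then show "{x \<in> carrier G. \<forall>n\<in>N. commutator G n x \<in> K} \<noteq> {}"
      by (auto intro!: exI[of _ \<one>])
  next
    fix x assume "x \<in> {x \<in> carrier G. \<forall>n\<in>N. commutator G n x \<in> K}"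
    then show "inv x \<in> {x \<in> carrier G. \<forall>n\<in>N. commutator G n x \<in> K}"
      using assms(1) by (auto simp: commutator_inv_right subset_iff intro: K.inv_op_closed2)
  next
    fix x y assume "x \<in> {x \<in> carrier G. \<forall>n\<in>N. commutator G n x \<in> K}"
      "y \<in> {x \<in> carrier G. \<forall>n\<in>N. commutator G n x \<in> K}"
    then show "x \<otimes> y \<in> {x \<in> carrier G. \<forall>n\<in>N. commutator G n x \<in> K}"
      using assms(1) by (auto simp: commutator_mult_right subset_iff intro!: K.m_closed K.inv_op_closed1)
  qed auto
qed

text \<open>
  By induction on \<open>k\<close>, for all normal \<open>N\<close> at once.  A generator of \<open>\<gamma>\<^bsub>k+2\<^esub>\<close> is \<open>[g, y]\<close> with \<open>g\<close> in
  \<open>\<gamma>\<^bsub>k+1\<^esub>\<close>.  In the Hall-Witt identity for \<open>g\<close>, \<open>y\<close> and \<open>n\<close>, the factor built from \<open>[[y, n], g]\<close> is covered by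
  the induction hypothesis for \<open>[N, G]\<close>, and the one built from \<open>[[n, g], y]\<close> by the induction hypothesis
  for \<open>N\<close>; hence the remaining one, built from \<open>[[g, y], n]\<close>, lies in the required subgroup.
\<close>

theorem commutator_lower_central_mem:
  assumes "N \<lhd> G" "n \<in> N" "g \<in> iterated_commutator G (carrier G) k"
  shows "commutator G n g \<in> iterated_commutator G N (Suc k)"
  using assms
proof (induction k arbitrary: N n g)
  case 0
  then show ?case by (auto intro: commutator_mem)
next
  case (Suc k)
  note N = \<open>N \<lhd> G\<close>
  let ?K = "iterated_commutator G N (Suc (Suc k))"
  let ?\<Gamma> = "iterated_commutator G (carrier G) k"
  have K: "?K \<lhd> G" using N by (rule normal_iterated_commutator)
  interpret K: normal ?K G by fact
  have NG: "commutator_subgroup G N (carrier G) \<lhd> G"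
    using N normal_self by (rule normal_commutator_subgroup)
  have \<Gamma>: "?\<Gamma> \<subseteq> carrier G"
    using normal_self normal_iterated_commutator normal_subset by blast
  have Nc: "N \<subseteq> carrier G" using N by (rule normal_subset)
  have "commutator G g y \<in> {x \<in> carrier G. \<forall>n\<in>N. commutator G n x \<in> ?K}"
    if g: "g \<in> ?\<Gamma>" and y: "y \<in> carrier G" for g y
  proof (intro CollectI conjI ballI)
    show "commutator G g y \<in> carrier G" using g y \<Gamma> by auto
    fix n assume n: "n \<in> N"
    have gc: "g \<in> carrier G" and nc: "n \<in> carrier G" using g n \<Gamma> Nc by auto
    have "inv n \<in> N" using n N by (simp add: normal_imp_subgroup subgroup.m_inv_closed)
    then have "commutator G (inv n) (inv y) \<in> commutator_subgroup G N (carrier G)"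
      using y by (intro commutator_mem) auto
    then have "commutator G (inv y) (inv n) \<in> commutator_subgroup G N (carrier G)"
      using subgroup.m_inv_closed[OF normal_imp_subgroup[OF NG]] y nc
      by (metis inv_closed inv_commutator)
    then have 2: "commutator G (commutator G (inv y) (inv n)) g \<in> ?K"
      using Suc.IH[OF NG _ g] by (simp add: iterated_commutator_Suc' del: iterated_commutator.simps)
    have "inv g \<in> ?\<Gamma>"
      using g by (meson normal_imp_subgroup normal_iterated_commutator normal_self subgroup.m_inv_closed)
    then have "commutator G n (inv g) \<in> iterated_commutator G N (Suc k)"
      using Suc.IH N n by blast
    then have 3: "commutator G (commutator G n (inv g)) (inv y) \<in> ?K"
      using y by (auto intro: commutator_mem)
    let ?a = "inv (inv y) \<otimes> commutator G (commutator G g (inv (inv y))) n \<otimes> inv y"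
    let ?b = "inv n \<otimes> commutator G (commutator G (inv y) (inv n)) g \<otimes> n"
    let ?c = "inv g \<otimes> commutator G (commutator G n (inv g)) (inv y) \<otimes> g"
    have bc: "?b \<otimes> ?c \<in> ?K"
      using 2 3 gc nc by (intro K.m_closed K.inv_op_closed1) auto
    have "?a \<otimes> (?b \<otimes> ?c) = \<one>"
      using Hall_Witt[of g "inv y" n] gc nc y by (simp add: m_assoc)
    then have "?a = inv (?b \<otimes> ?c)"
      using gc nc y by (intro inv_equality[symmetric]) auto
    then have "?a \<in> ?K" using K.m_inv_closed[OF bc] by (simp only:)
    then have "inv y \<otimes> ?a \<otimes> y \<in> ?K" using y by (rule normal_conj'[OF K])
    also have "inv y \<otimes> ?a \<otimes> y = commutator G (commutator G g y) n"
      using gc nc y by (simp add: word_simps)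
    finally have "inv (commutator G (commutator G g y) n) \<in> ?K" by (rule K.m_inv_closed)
    then show "commutator G n (commutator G g y) \<in> ?K"
      using gc nc y by (simp add: inv_commutator)
  qed
  then have "iterated_commutator G (carrier G) (Suc k) \<subseteq> {x \<in> carrier G. \<forall>n\<in>N. commutator G n x \<in> ?K}"
    unfolding iterated_commutator.simps(2)
    by (intro commutator_subgroup_least subgroup_centralizing_mod Nc K[unfolded iterated_commutator.simps(2)])
  then show ?case using Suc.prems by blast
qed

lemma coset_eq_iff:
  assumes "N \<lhd> G" "x \<in> carrier G" "y \<in> carrier G"
  shows "N #> x = N #> y \<longleftrightarrow> x \<otimes> inv y \<in> N"
proof -
  interpret N: normal N G by fact
  show ?thesis
    using assms N.rcos_module[OF is_group, of y x] N.subgroup_axioms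
    by (metis rcos_self repr_independence N.is_subgroup)
qed

lemma coset_eq_one_iff:
  assumes "N \<lhd> G" "x \<in> carrier G"
  shows "N #> x = N \<longleftrightarrow> x \<in> N"
  using assms by (metis coset_join1 coset_join2 normal_imp_subgroup subgroup.subset)

text \<open>
  Normality moves the right factor \<open>b\<close> past \<open>x\<close>.
\<close>

lemma coset_absorb:
  assumes "N \<lhd> G" "a \<in> N" "b \<in> N" "x \<in> carrier G"
  shows "N #> (a \<otimes> x \<otimes> b) = N #> x"
proof -
  interpret N: normal N G by fact
  have [simp]: "a \<in> carrier G" "b \<in> carrier G" using assms N.subset by auto
  have "a \<otimes> x \<otimes> b \<otimes> inv x = a \<otimes> (x \<otimes> b \<otimes> inv x)"
    using assms(4) by (simp add: m_assoc)
  also have "\<dots> \<in> N"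
    using assms by (intro N.m_closed N.inv_op_closed2)
  finally show ?thesis
    using assms by (simp add: coset_eq_iff)
qed

lemma group_hom_coset: "N \<lhd> G \<Longrightarrow> group_hom G (G Mod N) (\<lambda>x. N #> x)"
  by (simp add: group_hom_def group_hom_axioms_def normal.factorgroup_is_group normal.r_coset_hom_Mod)

end

lemma (in group_hom) hom_commutator:
  "\<lbrakk>x \<in> carrier G; y \<in> carrier G\<rbrakk> \<Longrightarrow> h (commutator G x y) = commutator H (h x) (h y)"
  by (simp add: commutator_def)

text \<open>
  Write \<open>k = d k'\<close> and \<open>y = m y'\<close>.  Expanding \<open>[d k', m y']\<close> yields \<open>[k', y']\<close> up to conjugates of
  \<open>[d, y]\<close> and \<open>[k', m]\<close>.  The first lies in \<open>[[N, G, \<dots>], G]\<close> by definition, the second by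
  \<open>commutator_lower_central_mem\<close>.
\<close>

lemma (in group) coset_commutator_cong:
  assumes N: "N \<lhd> G"
    and k: "k \<in> iterated_commutator G (carrier G) n" "k' \<in> iterated_commutator G (carrier G) n"
    and y: "y \<in> carrier G" "y' \<in> carrier G"
    and kk: "iterated_commutator G N n #> k = iterated_commutator G N n #> k'"
    and yy: "N #> y = N #> y'"
  shows "iterated_commutator G N (Suc n) #> commutator G k y =
         iterated_commutator G N (Suc n) #> commutator G k' y'"
proof -
  let ?D = "iterated_commutator G N n" and ?D' = "iterated_commutator G N (Suc n)"
  have D: "?D \<lhd> G" and D': "?D' \<lhd> G" using N by (simp_all only: normal_iterated_commutator)
  interpret q: group_hom G "G Mod ?D'" "\<lambda>x. ?D' #> x" by (rule group_hom_coset[OF D'])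
  have kc: "k \<in> carrier G" "k' \<in> carrier G"
    using k normal_subset[OF normal_iterated_commutator[OF normal_self]] by blast+
  define d where "d = k \<otimes> inv k'"
  define m where "m = y \<otimes> inv y'"
  have d: "d \<in> ?D" and m: "m \<in> N"
    using kk yy kc y by (simp_all add: d_def m_def coset_eq_iff[OF D] coset_eq_iff[OF N])
  have dc: "d \<in> carrier G" and mc: "m \<in> carrier G" using d m D N normal_subset by blast+
  have k_eq: "k = d \<otimes> k'" and y_eq: "y = m \<otimes> y'"
    using kc y by (simp_all add: d_def m_def m_assoc)
  have eq: "commutator G k y =
      (inv k' \<otimes> commutator G d y \<otimes> k') \<otimes> commutator G k' y' \<otimes> (inv y' \<otimes> commutator G k' m \<otimes> y')"
    unfolding k_eq y_eq using kc dc mc y by (simp add: commutator_def word_simps)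
  have "commutator G d y \<in> ?D'"
    using d y by (auto intro: commutator_mem)
  then have 1: "inv k' \<otimes> commutator G d y \<otimes> k' \<in> ?D'"
    using kc by (intro normal_conj'[OF D'])
  have "inv (commutator G m k') \<in> ?D'"
    using commutator_lower_central_mem[OF N m k(2)] D' by (simp only: normal_imp_subgroup subgroup.m_inv_closed)
  then have 2: "inv y' \<otimes> commutator G k' m \<otimes> y' \<in> ?D'"
    using kc mc y by (intro normal_conj'[OF D']) (simp_all add: inv_commutator)
  show ?thesis
    unfolding eq using coset_absorb[OF D' 1 2] kc y by (simp del: iterated_commutator.simps)
qed

lemma group_hom_compose:
  "\<lbrakk>group_hom G H f; group_hom H K g\<rbrakk> \<Longrightarrow> group_hom G K (g \<circ> f)"
  by (auto simp: group_hom_def group_hom_axioms_def intro: Group.hom_compose)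

lemma (in group_hom) hom_commutator_subgroup:
  assumes "A \<subseteq> carrier G" "B \<subseteq> carrier G" "h ` A \<subseteq> A'" "h ` B \<subseteq> B'" "A' \<subseteq> carrier H" "B' \<subseteq> carrier H"
  shows "h ` commutator_subgroup G A B \<subseteq> commutator_subgroup H A' B'"
proof -
  have mem: "a \<in> A \<Longrightarrow> a \<in> carrier G \<and> h a \<in> A'" "b \<in> B \<Longrightarrow> b \<in> carrier G \<and> h b \<in> B'" for a b
    using assms by blast+
  have "h ` commutator_subgroup G A B = generate H (h ` {commutator G a b | a b. a \<in> A \<and> b \<in> B})"
    unfolding commutator_subgroup_eq using assms by (intro generate_img[symmetric]) auto
  also have "\<dots> \<subseteq> commutator_subgroup H A' B'"
  proof (rule H.generate_subgroup_incl)
    show "h ` {commutator G a b | a b. a \<in> A \<and> b \<in> B} \<subseteq> commutator_subgroup H A' B'"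
      using mem by (auto simp: hom_commutator intro!: H.commutator_mem)
  qed (use assms in \<open>simp add: H.subgroup_commutator_subgroup\<close>)
  finally show ?thesis .
qed

lemma (in group_hom) hom_iterated_commutator:
  assumes "A \<subseteq> carrier G" "h ` A \<subseteq> A'" "A' \<subseteq> carrier H"
  shows "h ` iterated_commutator G A n \<subseteq> iterated_commutator H A' n"
proof -
  have "iterated_commutator G A n \<subseteq> carrier G \<and> h ` iterated_commutator G A n \<subseteq> iterated_commutator H A' n
      \<and> iterated_commutator H A' n \<subseteq> carrier H"
  proof (induction n)
    case (Suc n)
    then show ?case
      using hom_commutator_subgroup[of "iterated_commutator G A n" "carrier G" "iterated_commutator H A' n" "carrier H"]
        G.subgroup_commutator_subgroup[of "iterated_commutator G A n" "carrier G"]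
        H.subgroup_commutator_subgroup[of "iterated_commutator H A' n" "carrier H"]
        hom_closed
      by (simp add: subgroup.subset image_subset_iff)
  qed (use assms in auto)
  then show ?thesis by blast
qed

lemma (in group_hom) hom_lower_central:
  "x \<in> iterated_commutator G (carrier G) n \<Longrightarrow> h x \<in> iterated_commutator H (carrier H) n"
  using hom_iterated_commutator[of "carrier G" "carrier H" n] hom_closed by blast

lemma subgroup_equalizer:
  assumes "group_hom G H f" "group_hom G H g"
  shows "subgroup {x \<in> carrier G. f x = g x} G"
proof -
  interpret f: group_hom G H f by fact
  interpret g: group_hom G H g by fact
  show ?thesis by (rule f.G.subgroupI) (auto intro: exI[of _ "\<one>\<^bsub>G\<^esub>"])
qed

text \<open>
  This is why multipliers depend only on the group presented: two lifts of one homomorphism to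
  presenting groups differ by elements of the relation subgroup \<open>N\<close>, so they agree on \<open>\<gamma>\<^bsub>n+1\<^esub>\<close> modulo
  \<open>[N, H, \<dots>, H]\<close>.
\<close>

theorem congruent_homs_on_lower_central:
  assumes f: "group_hom G H f" and g: "group_hom G H g" and N: "N \<lhd> H"
    and fg: "\<And>x. x \<in> carrier G \<Longrightarrow> N #>\<^bsub>H\<^esub> f x = N #>\<^bsub>H\<^esub> g x"
    and "x \<in> iterated_commutator G (carrier G) n"
  shows "iterated_commutator H N n #>\<^bsub>H\<^esub> f x = iterated_commutator H N n #>\<^bsub>H\<^esub> g x"
  using assms(5)
proof (induction n arbitrary: x)
  case 0
  then show ?case using fg by simp
next
  case (Suc n)
  interpret f: group_hom G H f by fact
  interpret g: group_hom G H g by fact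
  let ?D = "iterated_commutator H N (Suc n)"
  have D: "?D \<lhd> H" using N by (rule f.H.normal_iterated_commutator)
  have q: "group_hom H (H Mod ?D) (\<lambda>x. ?D #>\<^bsub>H\<^esub> x)" by (rule f.H.group_hom_coset[OF D])
  let ?L = "{x \<in> carrier G. ?D #>\<^bsub>H\<^esub> f x = ?D #>\<^bsub>H\<^esub> g x}"
  have L: "subgroup ?L G"
    using subgroup_equalizer[of G "H Mod ?D" "(\<lambda>x. ?D #>\<^bsub>H\<^esub> x) \<circ> f" "(\<lambda>x. ?D #>\<^bsub>H\<^esub> x) \<circ> g"]
      group_hom_compose[OF f q] group_hom_compose[OF g q] by simp
  have "commutator G k y \<in> ?L"
    if k: "k \<in> iterated_commutator G (carrier G) n" and y: "y \<in> carrier G" for k y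
  proof -
    have kc: "k \<in> carrier G"
      using k f.G.iterated_commutator_subset[OF f.G.normal_self] by blast
    have "f k \<in> iterated_commutator H (carrier H) n" "g k \<in> iterated_commutator H (carrier H) n"
      using k by (simp_all add: f.hom_lower_central g.hom_lower_central)
    then show ?thesis
      using f.H.coset_commutator_cong[OF N, of "f k" n "g k" "f y" "g y"] Suc.IH[OF k] fg[OF y] kc y
      by (simp add: f.hom_commutator g.hom_commutator del: iterated_commutator.simps)
  qed
  then have "iterated_commutator G (carrier G) (Suc n) \<subseteq> ?L"
    using f.G.commutator_subgroup_least[OF L] by simp
  then show ?case using Suc.prems by blast
qed

text \<open>
  In other words, \<open>H = f(G) N\<close> implies \<open>\<gamma>\<^bsub>n+1\<^esub>(H) \<subseteq> f(\<gamma>\<^bsub>n+1\<^esub>(G)) [N, H, \<dots>, H]\<close>, since by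
  \<open>coset_commutator_cong\<close> a commutator may be replaced by one of entries congruent to the given ones.
\<close>

theorem lower_central_lift:
  assumes f: "group_hom G H f" and N: "N \<lhd> H"
    and surj: "\<And>y. y \<in> carrier H \<Longrightarrow> \<exists>x\<in>carrier G. N #>\<^bsub>H\<^esub> f x = N #>\<^bsub>H\<^esub> y"
    and "y \<in> iterated_commutator H (carrier H) n"
  shows "\<exists>x\<in>iterated_commutator G (carrier G) n.
    iterated_commutator H N n #>\<^bsub>H\<^esub> f x = iterated_commutator H N n #>\<^bsub>H\<^esub> y"
  using assms(4)
proof (induction n arbitrary: y)
  case 0
  then show ?case using surj by simp
next
  case (Suc n)
  interpret f: group_hom G H f by fact
  let ?D = "iterated_commutator H N (Suc n)" and ?\<Gamma> = "iterated_commutator G (carrier G) (Suc n)"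
  have D: "?D \<lhd> H" using N by (rule f.H.normal_iterated_commutator)
  interpret q: group_hom H "H Mod ?D" "\<lambda>x. ?D #>\<^bsub>H\<^esub> x" by (rule f.H.group_hom_coset[OF D])
  have \<Gamma>: "subgroup ?\<Gamma> G"
    using f.G.normal_iterated_commutator[OF f.G.normal_self] by (rule normal_imp_subgroup)
  interpret \<Gamma>: subgroup ?\<Gamma> G by fact
  let ?L = "{y \<in> carrier H. \<exists>x\<in>?\<Gamma>. ?D #>\<^bsub>H\<^esub> f x = ?D #>\<^bsub>H\<^esub> y}"
  have L: "subgroup ?L H"
  proof (rule f.H.subgroupI)
    show "?L \<noteq> {}"
      using \<Gamma>.one_closed f.hom_one by (auto intro!: exI[of _ "\<one>\<^bsub>H\<^esub>"] bexI[of _ "\<one>\<^bsub>G\<^esub>"])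
  next
    fix y assume "y \<in> ?L"
    then obtain x where "y \<in> carrier H" "x \<in> ?\<Gamma>" "?D #>\<^bsub>H\<^esub> f x = ?D #>\<^bsub>H\<^esub> y" by blast
    then show "inv\<^bsub>H\<^esub> y \<in> ?L"
      by (auto intro!: bexI[of _ "inv\<^bsub>G\<^esub> x"] simp: \<Gamma>.mem_carrier simp del: iterated_commutator.simps)
  next
    fix y y' assume "y \<in> ?L" "y' \<in> ?L"
    then obtain x x' where "y \<in> carrier H" "x \<in> ?\<Gamma>" "?D #>\<^bsub>H\<^esub> f x = ?D #>\<^bsub>H\<^esub> y"
      "y' \<in> carrier H" "x' \<in> ?\<Gamma>" "?D #>\<^bsub>H\<^esub> f x' = ?D #>\<^bsub>H\<^esub> y'" by blast
    then show "y \<otimes>\<^bsub>H\<^esub> y' \<in> ?L"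
      by (auto intro!: bexI[of _ "x \<otimes>\<^bsub>G\<^esub> x'"] simp: \<Gamma>.mem_carrier simp del: iterated_commutator.simps mult_FactGroup)
  qed auto
  have "commutator H k y \<in> ?L"
    if k: "k \<in> iterated_commutator H (carrier H) n" and y: "y \<in> carrier H" for k y
  proof -
    have kc: "k \<in> carrier H"
      using k f.H.iterated_commutator_subset[OF f.H.normal_self] by blast
    obtain k' where k': "k' \<in> iterated_commutator G (carrier G) n"
      "iterated_commutator H N n #>\<^bsub>H\<^esub> f k' = iterated_commutator H N n #>\<^bsub>H\<^esub> k"
      using Suc.IH[OF k] by blast
    have k'c: "k' \<in> carrier G"
      using k'(1) f.G.iterated_commutator_subset[OF f.G.normal_self] by blast
    obtain y' where y': "y' \<in> carrier G" "N #>\<^bsub>H\<^esub> f y' = N #>\<^bsub>H\<^esub> y" using surj[OF y] by blast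
    have "f k' \<in> iterated_commutator H (carrier H) n"
      using k' by (simp add: f.hom_lower_central)
    then have "?D #>\<^bsub>H\<^esub> f (commutator G k' y') = ?D #>\<^bsub>H\<^esub> commutator H k y"
      using f.H.coset_commutator_cong[OF N, of "f k'" n k "f y'" y] k k' y y' k'c
      by (simp add: f.hom_commutator del: iterated_commutator.simps)
    moreover have "commutator G k' y' \<in> ?\<Gamma>"
      using k' y' by (auto intro: f.G.commutator_mem)
    ultimately show ?thesis using kc y by blast
  qed
  then have "iterated_commutator H (carrier H) (Suc n) \<subseteq> ?L"
    using f.H.commutator_subgroup_least[OF L] by simp
  then show ?case using Suc.prems by blast
qed

section \<open>Word values\<close>

context group
begin

lemma word_value_Nil [simp]: "word_value G f [] = \<one>"
  by (simp add: word_value_def)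

lemma word_value_Cons [simp]: "word_value G f (l # w) = f l \<otimes> word_value G f w"
  by (simp add: word_value_def)

lemma word_value_closed: "\<lbrakk>f ` L \<subseteq> carrier G; w \<in> lists L\<rbrakk> \<Longrightarrow> word_value G f w \<in> carrier G"
  by (induction w) auto

lemma word_value_append:
  "\<lbrakk>f ` L \<subseteq> carrier G; v \<in> lists L; w \<in> lists L\<rbrakk> \<Longrightarrow>
     word_value G f (v @ w) = word_value G f v \<otimes> word_value G f w"
  by (induction v) (auto simp: m_assoc word_value_closed image_subset_iff)

lemma word_value_replicate:
  "s \<in> carrier G \<Longrightarrow> word_value G (\<lambda>x. x) (replicate n s) = s [^] n"
  by (induction n) (simp_all add: nat_pow_Suc2 del: nat_pow_Suc Group.nat_pow_Suc)

text \<open>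
  A set closed under inverses generates its subgroup as a monoid, so counting words bounds the subgroup.
\<close>

lemma generate_subset_word_values:
  assumes "S \<subseteq> carrier G" "\<And>s. s \<in> S \<Longrightarrow> inv s \<in> S"
  shows "generate G S \<subseteq> word_value G (\<lambda>x. x) ` lists S"
proof
  fix x assume "x \<in> generate G S"
  then show "x \<in> word_value G (\<lambda>x. x) ` lists S"
  proof induction
    case one
    show ?case by (rule image_eqI[of _ _ "[]"]) auto
  next
    case (incl s)
    then show ?case using assms by (intro image_eqI[of _ _ "[s]"]) auto
  next
    case (inv s)
    then show ?case using assms by (intro image_eqI[of _ _ "[inv s]"]) auto
  next
    case (eng x y)
    then obtain v w where "v \<in> lists S" "w \<in> lists S"
      "x = word_value G (\<lambda>x. x) v" "y = word_value G (\<lambda>x. x) w" by blast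
    then show ?case using assms
      by (intro image_eqI[of _ _ "v @ w"]) (auto simp: word_value_append[of _ S])
  qed
qed

section \<open>Baer's theorem\<close>

text \<open>
  Occurrences of a letter can be collected at the front without changing the length: the letters that
  they pass are conjugated, and so stay in \<open>S\<close>.
\<close>

lemma word_value_collect:
  assumes S: "S \<subseteq> carrier G" "\<And>s x. \<lbrakk>s \<in> S; x \<in> carrier G\<rbrakk> \<Longrightarrow> inv x \<otimes> s \<otimes> x \<in> S"
    and "s \<in> S" "w \<in> lists S" "j \<le> count_list w s"
  shows "\<exists>u\<in>lists S. length u + j = length w \<and>
           word_value G (\<lambda>x. x) w = s [^] j \<otimes> word_value G (\<lambda>x. x) u"
  using assms(4,5)
proof (induction w arbitrary: j rule: list.induct)
  case Nil
  then show ?case by auto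
next
  case (Cons a w)
  have a: "a \<in> S" "a \<in> carrier G" and w: "w \<in> lists S" using Cons.prems S by auto
  have sc: "s \<in> carrier G" using assms by auto
  have wc: "word_value G (\<lambda>x. x) v \<in> carrier G" if "v \<in> lists S" for v
    using S that word_value_closed[of "\<lambda>x. x" S] by auto
  show ?case
  proof (cases "a = s \<and> j > 0")
    case True
    then obtain i where i: "j = Suc i" by (cases j) auto
    then have "i \<le> count_list w s" using Cons.prems True by auto
    then obtain u where u: "u \<in> lists S" "length u + i = length w"
      "word_value G (\<lambda>x. x) w = s [^] i \<otimes> word_value G (\<lambda>x. x) u"
      using Cons.IH w by blast
    then have "word_value G (\<lambda>x. x) (a # w) = s [^] j \<otimes> word_value G (\<lambda>x. x) u"
      using True sc wc[OF u(1)] by (simp add: i nat_pow_Suc2 m_assoc del: nat_pow_Suc Group.nat_pow_Suc)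
    then show ?thesis using u i by auto
  next
    case False
    then have "j \<le> count_list w s" using Cons.prems by (auto split: if_splits)
    then obtain u where u: "u \<in> lists S" "length u + j = length w"
      "word_value G (\<lambda>x. x) w = s [^] j \<otimes> word_value G (\<lambda>x. x) u"
      using Cons.IH w by blast
    let ?b = "inv (s [^] j) \<otimes> a \<otimes> s [^] j"
    have "?b \<in> S" using S(2) a(1) sc by simp
    moreover have "word_value G (\<lambda>x. x) (a # w) = s [^] j \<otimes> word_value G (\<lambda>x. x) (?b # u)"
      using u sc a wc[OF u(1)] by (simp add: word_simps)
    ultimately show ?thesis using u by (intro bexI[of _ "?b # u"]) auto
  qed
qed

text \<open>
  A variant of Dietzmann's lemma.  A word of length above \<open>|S| m\<close> contains some letter more than \<open>m\<close>
  times; collecting \<open>m + 1\<close> copies at the front and rewriting them with at most \<open>m\<close> letters shortens the word.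
  So words of length at most \<open>|S| m\<close> represent all elements.  The classical lemma, where the elements of \<open>S\<close>
  have finite order, replaces the copies by the empty word.
\<close>

theorem finite_generate_if_powers_shorten:
  assumes S: "finite S" "S \<subseteq> carrier G"
    and inv: "\<And>s. s \<in> S \<Longrightarrow> inv s \<in> S"
    and conj: "\<And>s x. \<lbrakk>s \<in> S; x \<in> carrier G\<rbrakk> \<Longrightarrow> inv x \<otimes> s \<otimes> x \<in> S"
    and short: "\<And>s. s \<in> S \<Longrightarrow> \<exists>w\<in>lists S. length w \<le> m \<and> s [^] Suc m = word_value G (\<lambda>x. x) w"
  shows "finite (generate G S)"
proof -
  let ?v = "word_value G (\<lambda>x. x)"
  let ?B = "{w. set w \<subseteq> S \<and> length w \<le> card S * m}"
  have "?v w \<in> ?v ` ?B" if "w \<in> lists S" for w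
    using that
  proof (induction w rule: length_induct)
    case (1 w)
    show ?case
    proof (cases "length w \<le> card S * m")
      case True
      then show ?thesis using 1 by auto
    next
      case False
      have "\<exists>s\<in>S. Suc m \<le> count_list w s"
      proof (rule ccontr)
        assume "\<not> ?thesis"
        then have "(\<Sum>s\<in>S. count_list w s) \<le> card S * m"
          using sum_bounded_above[of S "count_list w" m] by (auto simp: not_less_eq_eq)
        moreover have "(\<Sum>s\<in>S. count_list w s) = length w"
          using S 1 by (intro sum_count_set) auto
        ultimately show False using False by simp
      qed
      then obtain s where s: "s \<in> S" "Suc m \<le> count_list w s" by blast
      obtain u where u: "u \<in> lists S" "length u + Suc m = length w" "?v w = s [^] Suc m \<otimes> ?v u"
        using word_value_collect[OF S(2) conj s(1) "1.prems" s(2)] by blast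
      obtain v where v: "v \<in> lists S" "length v \<le> m" "s [^] Suc m = ?v v"
        using short[OF s(1)] by blast
      have "?v w = ?v (v @ u)"
        using u v S by (simp add: word_value_append[of _ S] del: nat_pow_Suc)
      moreover have "v @ u \<in> lists S" "length (v @ u) < length w"
        using u v by auto
      ultimately show ?thesis using "1.IH" by auto
    qed
  qed
  then have "generate G S \<subseteq> ?v ` ?B"
    using generate_subset_word_values[OF S(2) inv] by blast
  then show ?thesis
    using finite_lists_length_le[OF S(1)] by (meson finite_imageI finite_subset)
qed

lemma conj_nat_pow:
  assumes "x \<in> carrier G" "y \<in> carrier G"
  shows "inv y \<otimes> x [^] (n::nat) \<otimes> y = (inv y \<otimes> x \<otimes> y) [^] n"
proof (induction n)
  case (Suc n)
  have "inv y \<otimes> x [^] Suc n \<otimes> y = (inv y \<otimes> x [^] n \<otimes> y) \<otimes> (inv y \<otimes> x \<otimes> y)"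
    using assms by (simp add: word_simps)
  then show ?case using Suc.IH by simp
qed (use assms in simp)

text \<open>
  The identity behind Schur's theorem on groups with a central subgroup of finite index.  With \<open>u = [x, y]\<close>
  and \<open>u'\<close> its conjugate by \<open>y\<close>, the hypothesis gives \<open>u\<^bsup>m+1\<^esup> = u'\<^bsup>m+1\<^esup>\<close>; split off one \<open>u'\<close> and use
  \<open>u u' = [x, y\<^sup>2]\<close>.  Thus \<open>m + 2\<close> commutators become \<open>m + 1\<close>.
\<close>

lemma commutator_power_shorten:
  assumes x: "x \<in> carrier G" "y \<in> carrier G"
    and comm: "commutator G x y [^] Suc m \<otimes> y = y \<otimes> commutator G x y [^] Suc m"
  shows "commutator G x y [^] Suc (Suc m) =
    commutator G x (y \<otimes> y) \<otimes> commutator G (inv y \<otimes> x \<otimes> y) y [^] m"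
proof -
  let ?u = "commutator G x y" and ?u' = "commutator G (inv y \<otimes> x \<otimes> y) y"
  have u': "?u' = inv y \<otimes> ?u \<otimes> y"
    using x by (simp add: commutator_def word_simps)
  have "?u [^] Suc (Suc m) = ?u \<otimes> ?u [^] Suc m"
    using x by (intro nat_pow_Suc2) auto
  also have "?u [^] Suc m = inv y \<otimes> ?u [^] Suc m \<otimes> y"
    using comm x by (simp add: m_assoc inv_cancel_left del: nat_pow_Suc)
  also have "\<dots> = ?u' [^] Suc m"
    unfolding u' using x by (intro conj_nat_pow) auto
  also have "\<dots> = ?u' \<otimes> ?u' [^] m"
    using x by (intro nat_pow_Suc2) auto
  also have "?u \<otimes> (?u' \<otimes> ?u' [^] m) = (?u \<otimes> ?u') \<otimes> ?u' [^] m"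
    using x by (simp add: m_assoc)
  also have "?u \<otimes> ?u' = commutator G x (y \<otimes> y)"
    unfolding u' using x by (simp add: commutator_mult_right)
  finally show ?thesis .
qed

text \<open>
  The commutators \<open>[k, x]\<close> form a set that is closed under conjugation and, because
  \<open>[k, x]\<inverse> = [k\<^sup>x, x\<inverse>]\<close>, under inverses; \<open>commutator_power_shorten\<close> shortens their powers.  So finiteness passes from
  the set of commutators to the subgroup that it generates.
\<close>

theorem finite_commutator_subgroup:
  assumes K: "K \<lhd> G"
    and fin: "finite {commutator G k x | k x. k \<in> K \<and> x \<in> carrier G}"
    and pow: "\<And>k x. \<lbrakk>k \<in> K; x \<in> carrier G\<rbrakk> \<Longrightarrow> k [^] Suc m \<otimes> x = x \<otimes> k [^] Suc m"
  shows "finite (commutator_subgroup G K (carrier G))"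
  unfolding commutator_subgroup_eq
proof (rule finite_generate_if_powers_shorten[where m = "Suc m"])
  let ?S = "{commutator G k x | k x. k \<in> K \<and> x \<in> carrier G}"
  interpret K: normal K G by fact
  have Kc: "k \<in> carrier G" if "k \<in> K" for k using that K.subset by blast
  show "finite ?S" by fact
  show "?S \<subseteq> carrier G" using Kc by auto
  have conj: "inv x \<otimes> commutator G k y \<otimes> x = commutator G (inv x \<otimes> k \<otimes> x) (inv x \<otimes> y \<otimes> x)"
    if "k \<in> K" "x \<in> carrier G" "y \<in> carrier G" for k x y
    using that Kc by (simp add: commutator_def word_simps)
  show "inv x \<otimes> s \<otimes> x \<in> ?S" if "s \<in> ?S" "x \<in> carrier G" for s x
    using that conj normal_conj'[OF K] by fastforce
  show "inv s \<in> ?S" if s: "s \<in> ?S" for s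
  proof -
    obtain k x where kx: "k \<in> K" "x \<in> carrier G" "s = commutator G k x" using s by blast
    have "inv s = commutator G (inv x \<otimes> k \<otimes> x) (inv x)"
      using kx Kc by (simp add: commutator_def word_simps)
    then show ?thesis using kx normal_conj'[OF K kx(1,2)] by blast
  qed
  show "\<exists>w\<in>lists ?S. length w \<le> Suc m \<and> s [^] Suc (Suc m) = word_value G (\<lambda>x. x) w"
    if s: "s \<in> ?S" for s
  proof -
    obtain k x where kx: "k \<in> K" "x \<in> carrier G" "s = commutator G k x" using s by blast
    let ?w = "commutator G k (x \<otimes> x) # replicate m (commutator G (inv x \<otimes> k \<otimes> x) x)"
    have "s [^] Suc (Suc m) = word_value G (\<lambda>x. x) ?w"
      using commutator_power_shorten[of k x m] pow[OF normal_commutator_mem[OF K]] kx Kc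
      by (simp add: word_value_replicate del: nat_pow_Suc)
    moreover have "?w \<in> lists ?S"
      using kx normal_conj'[OF K kx(1,2)] m_closed[OF kx(2,2)]
      by (auto simp: in_lists_conv_set set_replicate_conv_if split: if_splits)
    ultimately show ?thesis by (intro bexI[of _ ?w]) auto
  qed
qed

end

text \<open>
  Used to bound the number of commutators: \<open>f\<close> is constant on the fibres of a map \<open>g\<close> with finite image.
\<close>

lemma finite_image_factor:
  assumes "finite (g ` A)" "\<And>x y. \<lbrakk>x \<in> A; y \<in> A; g x = g y\<rbrakk> \<Longrightarrow> f x = f y"
  shows "finite (f ` A)"
proof -
  have "f x = f (inv_into A g (g x))" if "x \<in> A" for x
    using that by (intro assms(2)) (auto simp: inv_into_into f_inv_into_f)
  then have "f ` A \<subseteq> (\<lambda>c. f (inv_into A g c)) ` g ` A" by blast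
  then show ?thesis using assms(1) by (meson finite_imageI finite_subset)
qed

lemma (in group) finite_subgroup_exponent:
  assumes H: "subgroup H G" and fin: "finite H"
  shows "\<exists>m. \<forall>x\<in>H. x [^] Suc m = \<one>"
proof -
  interpret H: group "G\<lparr>carrier := H\<rparr>" using H by (rule subgroup_imp_group)
  have "card H > 0" using subgroup.one_closed[OF H] fin card_gt_0_iff by blast
  then have "card H = Suc (card H - 1)" by simp
  moreover have "x [^] card H = \<one>" if "x \<in> H" for x
    using that H.pow_order_eq_1[of x] by (simp add: order_def nat_pow_consistent[symmetric])
  ultimately show ?thesis by metis
qed

text \<open>
  Baer's theorem: if \<open>G/R\<close> is finite, so is the image of \<open>\<gamma>\<^bsub>n+1\<^esub>(G)\<close> in \<open>G/[R, G, \<dots>, G]\<close>.  By induction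
  on \<open>n\<close>: modulo \<open>D' = [D, G]\<close> with \<open>D = [R, G, \<dots>, G]\<close>, the commutator of \<open>k \<in> \<gamma>\<^bsub>n+1\<^esub>\<close> and \<open>x\<close> depends only on the
  coset of \<open>k\<close> modulo \<open>D\<close> and that of \<open>x\<close> modulo \<open>R\<close>, so there are finitely many commutators.  As \<open>\<gamma>\<^bsub>n+1\<^esub>\<close> is
  finite modulo \<open>D\<close> and \<open>D\<close> is central modulo \<open>D'\<close>, a fixed power of every \<open>k\<close> is central modulo \<open>D'\<close>, and
  \<open>finite_commutator_subgroup\<close> applies in \<open>G/D'\<close>.
\<close>

theorem (in group) Baer_finite:
  assumes R: "R \<lhd> G" and fin: "finite (carrier (G Mod R))"
  shows "finite ((\<lambda>g. iterated_commutator G R n #> g) ` iterated_commutator G (carrier G) n)"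
proof (induction n)
  case 0
  then show ?case using fin by (simp add: carrier_FactGroup)
next
  case (Suc n)
  let ?D = "iterated_commutator G R n" and ?D' = "iterated_commutator G R (Suc n)"
  let ?\<Gamma> = "iterated_commutator G (carrier G) n"
  let ?Y = "G Mod ?D'" and ?\<pi> = "\<lambda>g. ?D' #> g"
  have D: "?D \<lhd> G" and D': "?D' \<lhd> G" and \<Gamma>: "?\<Gamma> \<lhd> G"
    using R normal_self by (simp_all only: normal_iterated_commutator)
  interpret q: group_hom G ?Y ?\<pi> by (rule group_hom_coset[OF D'])
  interpret p: group_hom G "G Mod ?D" "\<lambda>g. ?D #> g" by (rule group_hom_coset[OF D])
  have \<Gamma>c: "k \<in> carrier G" if "k \<in> ?\<Gamma>" for k using that normal_subset[OF \<Gamma>] by blast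
  have K: "?\<pi> ` ?\<Gamma> \<lhd> ?Y"
    using normal.surj_hom_normal_subgroup[OF \<Gamma> q.group_hom_axioms] by (simp add: carrier_FactGroup)
  let ?S = "{commutator ?Y k x | k x. k \<in> ?\<pi> ` ?\<Gamma> \<and> x \<in> carrier ?Y}"
  have "finite ((\<lambda>(k, x). ?\<pi> (commutator G k x)) ` (?\<Gamma> \<times> carrier G))"
  proof (rule finite_image_factor[where g = "\<lambda>(k, x). (?D #> k, R #> x)"])
    have "(\<lambda>(k, x). (?D #> k, R #> x)) ` (?\<Gamma> \<times> carrier G) \<subseteq> (\<lambda>k. ?D #> k) ` ?\<Gamma> \<times> (\<lambda>x. R #> x) ` carrier G"
      by auto
    then show "finite ((\<lambda>(k, x). (?D #> k, R #> x)) ` (?\<Gamma> \<times> carrier G))"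
      using Suc.IH fin by (simp add: carrier_FactGroup finite_cartesian_product finite_subset)
  next
    fix u v assume "u \<in> ?\<Gamma> \<times> carrier G" "v \<in> ?\<Gamma> \<times> carrier G"
      "(\<lambda>(k, x). (?D #> k, R #> x)) u = (\<lambda>(k, x). (?D #> k, R #> x)) v"
    then show "(\<lambda>(k, x). ?\<pi> (commutator G k x)) u = (\<lambda>(k, x). ?\<pi> (commutator G k x)) v"
      using coset_commutator_cong[OF R, of "fst u" n "fst v" "snd u" "snd v"]
      by (simp add: case_prod_beta mem_Times_iff del: iterated_commutator.simps)
  qed
  moreover have "?S = (\<lambda>(k, x). ?\<pi> (commutator G k x)) ` (?\<Gamma> \<times> carrier G)"
    using \<Gamma>c by (force simp: carrier_FactGroup q.hom_commutator simp del: iterated_commutator.simps)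
  ultimately have finS: "finite ?S" by simp
  have "subgroup ((\<lambda>g. ?D #> g) ` ?\<Gamma>) (G Mod ?D)"
    using \<Gamma> by (intro p.subgroup_img_is_subgroup normal_imp_subgroup)
  then obtain m where m: "(?D #> k) [^]\<^bsub>G Mod ?D\<^esub> Suc m = \<one>\<^bsub>G Mod ?D\<^esub>" if "k \<in> ?\<Gamma>" for k
    using p.H.finite_subgroup_exponent Suc.IH by blast
  have "finite (commutator_subgroup ?Y (?\<pi> ` ?\<Gamma>) (carrier ?Y))"
  proof (rule q.H.finite_commutator_subgroup[OF K finS])
    fix k x assume "k \<in> ?\<pi> ` ?\<Gamma>" "x \<in> carrier ?Y"
    then obtain k' x' where k: "k = ?\<pi> k'" "k' \<in> ?\<Gamma>" and x: "x = ?\<pi> x'" "x' \<in> carrier G"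
      by (auto simp: carrier_FactGroup)
    define z where "z = k' [^] Suc m"
    have z: "z \<in> carrier G" using \<Gamma>c[OF k(2)] by (simp add: z_def)
    have "?D #> z = \<one>\<^bsub>G Mod ?D\<^esub>"
      using m[OF k(2)] \<Gamma>c[OF k(2)] unfolding z_def by (simp only: p.hom_nat_pow)
    then have "z \<in> ?D"
      using coset_eq_one_iff[OF D z] by simp
    then have "commutator G z x' \<in> ?D'"
      using x by (auto intro: commutator_mem)
    then have "commutator ?Y (?\<pi> z) (?\<pi> x') = \<one>\<^bsub>?Y\<^esub>"
      using coset_eq_one_iff[OF D'] z x
      by (simp del: iterated_commutator.simps flip: q.hom_commutator)
    moreover have "?\<pi> z = k [^]\<^bsub>?Y\<^esub> Suc m"
      using \<Gamma>c[OF k(2)] unfolding z_def k(1) by (rule q.hom_nat_pow)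
    ultimately show "k [^]\<^bsub>?Y\<^esub> Suc m \<otimes>\<^bsub>?Y\<^esub> x = x \<otimes>\<^bsub>?Y\<^esub> k [^]\<^bsub>?Y\<^esub> Suc m"
      using q.H.commutator_eq_one_iff z x q.hom_closed by metis
  qed
  moreover have "?\<pi> ` iterated_commutator G (carrier G) (Suc n) \<subseteq> commutator_subgroup ?Y (?\<pi> ` ?\<Gamma>) (carrier ?Y)"
    unfolding iterated_commutator.simps(2)[of G "carrier G"]
    using \<Gamma>c normal_subset q.H.normal_subset[OF K]
    by (intro q.hom_commutator_subgroup) (auto simp: carrier_FactGroup)
  ultimately show ?case by (rule finite_subset[rotated])
qed

section \<open>Homomorphic images of finite abelian groups\<close>

context comm_group
begin

lemma conj_trivial: "\<lbrakk>x \<in> carrier G; y \<in> carrier G\<rbrakk> \<Longrightarrow> x \<otimes> y \<otimes> inv x = y"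
  by (simp add: m_comm[of x y] m_assoc)

lemma subgroup_adjoin:
  assumes "subgroup B G" "y \<in> carrier G"
  shows "subgroup {y [^] (i::int) \<otimes> b | i b. b \<in> B} G"
proof -
  interpret B: subgroup B G by fact
  have Bc: "b \<in> carrier G" if "b \<in> B" for b using that B.subset by blast
  show ?thesis
  proof (rule subgroupI)
    show "{y [^] (i::int) \<otimes> b | i b. b \<in> B} \<subseteq> carrier G" using Bc assms by auto
    show "{y [^] (i::int) \<otimes> b | i b. b \<in> B} \<noteq> {}" using B.one_closed by blast
  next
    fix a assume "a \<in> {y [^] (i::int) \<otimes> b | i b. b \<in> B}"
    then obtain i :: int and b where a: "a = y [^] i \<otimes> b" "b \<in> B" by blast
    then have "inv a = y [^] (- i) \<otimes> inv b"
      using assms Bc by (simp add: inv_mult int_pow_neg)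
    then show "inv a \<in> {y [^] (i::int) \<otimes> b | i b. b \<in> B}" using a B.m_inv_closed by blast
  next
    fix a a' assume "a \<in> {y [^] (i::int) \<otimes> b | i b. b \<in> B}" "a' \<in> {y [^] (i::int) \<otimes> b | i b. b \<in> B}"
    then obtain i j :: int and b b' where a: "a = y [^] i \<otimes> b" "b \<in> B" "a' = y [^] j \<otimes> b'" "b' \<in> B"
      by blast
    then have "a \<otimes> a' = y [^] (i + j) \<otimes> (b \<otimes> b')"
      using assms Bc by (simp add: m_ac flip: int_pow_mult)
    then show "a \<otimes> a' \<in> {y [^] (i::int) \<otimes> b | i b. b \<in> B}" using a B.m_closed by blast
  qed
qed

text \<open>
  Modulo \<open>B\<close> the element \<open>z\<close> has order exactly \<open>p\<close>.
\<close>

lemma dvd_if_int_pow_mem: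
  assumes B: "subgroup B G" and p: "prime (p::nat)" and z: "z \<in> carrier G" "z \<notin> B" "z [^] int p \<in> B"
    and u: "z [^] (u::int) \<in> B"
  shows "int p dvd u"
proof (rule ccontr)
  assume "\<not> ?thesis"
  then have "coprime (int p) u"
    using p by (simp add: prime_imp_coprime)
  then obtain s t where st: "s * int p + t * u = 1"
    using bezout_int[of "int p" u] by auto
  have "z [^] (1::int) = (z [^] int p) [^] s \<otimes> (z [^] u) [^] t"
    using z by (simp add: int_pow_pow int_pow_mult[symmetric] st[symmetric] mult.commute)
  also have "\<dots> \<in> B"
    by (intro subgroup.m_closed[OF B] subgroup_int_pow_closed[OF B] z u)
  finally show False using z by simp
qed

text \<open>
  The subgroup \<open>B\<close> complements \<open>\<langle>y\<rangle>\<close>.  Take \<open>B\<close> maximal among the subgroups that contain all powers with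
  exponent \<open>q = p\<^bsup>k+1\<^esup>\<close> but not \<open>z\<close>; the height assumption on \<open>z\<close> says that the subgroup of these powers is a
  candidate.  By maximality every nontrivial subgroup of \<open>G/B\<close> contains the image of \<open>z\<close>.

  If \<open>C = \<langle>y\<rangle>B\<close> were not the whole group, there would be \<open>x\<close> outside \<open>C\<close> whose \<open>p\<close>-th power is in \<open>C\<close>, since \<open>G/B\<close> has
  exponent dividing \<open>q\<close>.  As \<open>x\<^sup>q\<close> is in \<open>B\<close>, the exponent of \<open>y\<close> in \<open>x\<^sup>p\<close> is divisible by \<open>p\<close>, so \<open>x\<close> can be
  multiplied by a power of \<open>y\<close> to give an element \<open>w\<close> outside \<open>C\<close> with \<open>w\<^sup>p\<close> in \<open>B\<close>.  The subgroup \<open>\<langle>w\<rangle>B\<close> contains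
  \<open>z\<close>, say \<open>z = w\<^sup>j b\<close>.  As \<open>z\<close> is in \<open>C\<close>, so is \<open>w\<^sup>j\<close>; hence \<open>p\<close> divides \<open>j\<close>, and \<open>z\<close> lies in \<open>B\<close>, a
  contradiction.
\<close>

lemma cyclic_complement:
  assumes fin: "finite (carrier G)" and p: "prime (p::nat)" and y: "y \<in> carrier G"
    and z: "z = y [^] (int p ^ k)" "z \<noteq> \<one>" "z [^] int p = \<one>"
    and height: "\<And>x. x \<in> carrier G \<Longrightarrow> x [^] (int p ^ Suc k) \<noteq> z"
  shows "\<exists>B. subgroup B G \<and> z \<notin> B \<and> (\<forall>x\<in>carrier G. \<exists>i::int. x \<otimes> y [^] i \<in> B)"
proof -
  let ?q = "int p ^ Suc k"
  have zc: "z \<in> carrier G" using y z by simp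
  let ?P = "{B. subgroup B G \<and> (\<forall>x\<in>carrier G. x [^] ?q \<in> B) \<and> z \<notin> B}"
  have "subgroup ((\<lambda>x. x [^] ?q) ` carrier G) G"
    by (rule group_hom.img_is_subgroup[where G = G])
      (auto simp: group_hom_def group_hom_axioms_def hom_def int_pow_distrib)
  then have ne: "(\<lambda>x. x [^] ?q) ` carrier G \<in> ?P" using height by auto
  have "finite ?P"
    by (rule finite_subset[of _ "Pow (carrier G)"]) (use fin in \<open>auto dest: subgroup.subset\<close>)
  then obtain B where B: "B \<in> ?P" and max: "\<And>B'. \<lbrakk>B' \<in> ?P; B \<subseteq> B'\<rbrakk> \<Longrightarrow> B' = B"
    using finite_has_maximal[of ?P] ne by (metis (no_types, lifting) empty_iff)
  have Bs: "subgroup B G" and Bq: "\<And>x. x \<in> carrier G \<Longrightarrow> x [^] ?q \<in> B" and zB: "z \<notin> B"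
    using B by auto
  interpret B: subgroup B G by fact
  have Bc: "b \<in> carrier G" if "b \<in> B" for b using that B.subset by blast
  let ?C = "{y [^] (i::int) \<otimes> b | i b. b \<in> B}"
  have C: "subgroup ?C G" using Bs y by (rule subgroup_adjoin)
  interpret C: subgroup ?C G by fact
  have BC: "B \<subseteq> ?C"
  proof
    fix b assume b: "b \<in> B"
    then have "b = y [^] (0::int) \<otimes> b" using Bc by simp
    then show "b \<in> ?C" using b by blast
  qed
  have yC: "y [^] (i::int) \<in> ?C" for i
  proof -
    have "y [^] i = y [^] i \<otimes> \<one>" using y by simp
    then show ?thesis using B.one_closed by blast
  qed
  have step: "x \<in> ?C" if x: "x \<in> carrier G" and xp: "x [^] int p \<in> ?C" for x
  proof (rule ccontr)
    assume xC: "x \<notin> ?C"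
    obtain m :: int and b where m: "x [^] int p = y [^] m \<otimes> b" and b: "b \<in> B"
      using xp by blast
    have "x [^] ?q = (y [^] m \<otimes> b) [^] (int p ^ k)"
      using x by (simp add: int_pow_pow flip: m)
    also have "\<dots> = z [^] m \<otimes> b [^] (int p ^ k)"
      using b Bc y by (simp add: int_pow_distrib int_pow_pow z mult.commute)
    finally have "z [^] m = x [^] ?q \<otimes> inv (b [^] (int p ^ k))"
      using b Bc zc by (simp add: m_assoc)
    also have "\<dots> \<in> B"
      by (intro B.m_closed B.m_inv_closed subgroup_int_pow_closed[OF Bs] Bq x b)
    finally have zm: "z [^] m \<in> B" .
    have "z [^] int p \<in> B" using z(3) B.one_closed by simp
    then have "int p dvd m" using zm by (rule dvd_if_int_pow_mem[OF Bs p zc zB])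
    then obtain m' where m': "m = int p * m'" by blast
    define w where "w = x \<otimes> y [^] (- m')"
    have wc: "w \<in> carrier G" using x y by (simp add: w_def)
    have x_eq: "x = w \<otimes> y [^] m'"
      using x y by (simp add: w_def m_assoc flip: int_pow_mult)
    have "w [^] int p = x [^] int p \<otimes> y [^] (- m)"
      using x y by (simp add: w_def int_pow_distrib int_pow_pow m' mult.commute)
    also have "\<dots> = b"
      using conj_trivial[of "y [^] m" b] b Bc y by (simp add: m int_pow_neg)
    finally have wp: "w [^] int p \<in> B" using b by simp
    have wC: "w \<notin> ?C"
    proof
      assume "w \<in> ?C"
      then have "w \<otimes> y [^] m' \<in> ?C" using yC by (rule C.m_closed)
      then show False using xC by (simp only: x_eq[symmetric])
    qed
    let ?W = "{w [^] (i::int) \<otimes> b | i b. b \<in> B}"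
    have W: "subgroup ?W G" using Bs wc by (rule subgroup_adjoin)
    have BW: "B \<subseteq> ?W"
    proof
      fix b assume b: "b \<in> B"
      then have "b = w [^] (0::int) \<otimes> b" using Bc by simp
      then show "b \<in> ?W" using b by blast
    qed
    have "w \<in> ?W"
    proof -
      have "w = w [^] (1::int) \<otimes> \<one>" using wc by simp
      then show ?thesis using B.one_closed by blast
    qed
    then have "?W \<noteq> B" using wC BC by blast
    moreover have "z \<notin> ?W \<Longrightarrow> ?W \<in> ?P"
      using W BW Bq by blast
    ultimately have "z \<in> ?W"
      using max[OF _ BW] by blast
    then obtain j :: int and b' where j: "z = w [^] j \<otimes> b'" "b' \<in> B" by blast
    have "z \<in> ?C"
      using yC[of "int p ^ k"] z by simp
    moreover have "inv b' \<in> ?C"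
      using j BC by (intro C.m_inv_closed) blast
    ultimately have "z \<otimes> inv b' \<in> ?C" by (rule C.m_closed)
    moreover have "z \<otimes> inv b' = w [^] j"
      using j Bc wc by (simp add: m_assoc)
    ultimately have "w [^] j \<in> ?C" by (simp only:)
    then have "int p dvd j"
      using dvd_if_int_pow_mem[OF C p wc wC] wp BC by blast
    then obtain j' where "j = int p * j'" by blast
    then have "z = (w [^] int p) [^] j' \<otimes> b'"
      using j wc by (simp add: int_pow_pow)
    then have "z \<in> B"
      using wp j subgroup_int_pow_closed[OF Bs] by auto
    then show False using zB by simp
  qed
  have CG: "x \<in> ?C" if x: "x \<in> carrier G" for x
  proof -
    have "x [^] (int p ^ (Suc k - j)) \<in> ?C" if "j \<le> Suc k" for j
      using that
    proof (induction j)
      case 0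
      then show ?case using Bq[OF x] BC by (simp only: diff_zero subsetD)
    next
      case (Suc j)
      have "(x [^] (int p ^ (Suc k - Suc j))) [^] int p = x [^] (int p ^ (Suc k - j))"
        using x Suc.prems by (simp add: int_pow_pow Suc_diff_le flip: power_Suc2)
      moreover have "x [^] (int p ^ (Suc k - j)) \<in> ?C"
        using Suc.IH Suc_leD[OF Suc.prems] by (simp only:)
      ultimately show ?case using x by - (rule step, simp_all only: int_pow_closed)
    qed
    from this[of "Suc k"] have "x [^] (int p ^ (Suc k - Suc k)) \<in> ?C" by (simp only: le_refl)
    moreover have "x [^] (int p ^ (Suc k - Suc k)) = x" using x by simp
    ultimately show ?thesis by (simp only:)
  qed
  have "\<exists>i::int. x \<otimes> y [^] i \<in> B" if x: "x \<in> carrier G" for x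
  proof -
    obtain i :: int and b where ib: "x = y [^] i \<otimes> b" "b \<in> B" using CG[OF x] by blast
    then have "x \<otimes> y [^] (- i) = b"
      using conj_trivial[of "y [^] i" b] y Bc by (simp add: int_pow_neg)
    then show ?thesis using ib by metis
  qed
  then show ?thesis using Bs zB by blast
qed

text \<open>
  Write \<open>z\<close> as a \<open>p\<^sup>k\<close>-th power of some \<open>y\<close> with \<open>k\<close> as large as possible; then \<open>y\<close> has order \<open>p\<^bsup>k+1\<^esup>\<close>.  The group is
  the direct product of \<open>\<langle>y\<rangle>\<close> and the complement \<open>B\<close> from \<open>cyclic_complement\<close>.  The endomorphism is the identity
  on \<open>B\<close> and the \<open>p\<close>-th power on \<open>\<langle>y\<rangle>\<close>, so its kernel is the subgroup of order \<open>p\<close> of \<open>\<langle>y\<rangle>\<close>, which is \<open>\<langle>z\<rangle>\<close>.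
\<close>

lemma endomorphism_killing_prime_order:
  assumes fin: "finite (carrier G)" and p: "prime (p::nat)"
    and z: "z \<in> carrier G" "z \<noteq> \<one>" "z [^] int p = \<one>"
  shows "\<exists>f\<in>hom G G. \<forall>x\<in>carrier G. f x = \<one> \<longleftrightarrow> (\<exists>t::int. x = z [^] t)"
proof -
  define h where "h k \<longleftrightarrow> (\<exists>y\<in>carrier G. y [^] (int p ^ k) = z)" for k
  have bound: "k < order G" if h: "h k" for k
  proof -
    obtain y where y: "y \<in> carrier G" "y [^] (int p ^ k) = z" using h unfolding h_def by blast
    have "y [^] (p ^ k) = z"
      using y by (simp flip: int_pow_int of_nat_power)
    moreover have "y [^] (p ^ k * p) = (y [^] (p ^ k)) [^] p"
      using y by (simp add: nat_pow_pow)
    ultimately have "\<not> ord y dvd p ^ k" "ord y dvd p ^ Suc k"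
      using y z by (simp_all add: int_pow_int mult.commute flip: pow_eq_id)
    moreover obtain i where "i \<le> Suc k" "ord y = p ^ i"
      using divides_primepow_nat[OF p] \<open>ord y dvd p ^ Suc k\<close> by blast
    ultimately have "ord y = p ^ Suc k"
      by (metis le_SucE le_imp_power_dvd)
    then have "p ^ Suc k \<le> order G"
      using ord_le_group_order[OF fin y(1)] by simp
    moreover have "Suc k < p ^ Suc k"
      using prime_gt_1_nat[OF p] by (intro power_gt_expt) simp
    ultimately show ?thesis by linarith
  qed
  have "h 0" using z by (auto simp: h_def)
  moreover have "\<forall>k. h k \<longrightarrow> k \<le> order G" using bound less_imp_le by blast
  ultimately obtain k where k: "h k" and max: "\<And>k'. h k' \<Longrightarrow> k' \<le> k"
    using Nat.ex_has_greatest_nat[of h 0 "order G"] by blast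
  obtain y where y: "y \<in> carrier G" and zy: "z = y [^] (int p ^ k)" using k unfolding h_def by blast
  let ?q = "int p ^ Suc k"
  have "x [^] ?q \<noteq> z" if "x \<in> carrier G" for x using max[of "Suc k"] that unfolding h_def by auto
  then obtain B where B: "subgroup B G" and zB: "z \<notin> B"
    and ex: "\<And>x. x \<in> carrier G \<Longrightarrow> \<exists>i::int. x \<otimes> y [^] i \<in> B"
    using cyclic_complement[OF fin p y zy z(2,3)] by blast
  interpret B: subgroup B G by fact
  have yq: "y [^] (?q * t) = \<one>" for t
  proof -
    have "y [^] (?q * t) = (z [^] int p) [^] t"
      using y by (simp add: zy int_pow_pow mult.commute)
    then show ?thesis using z by simp
  qed
  have yB: "?q dvd j" if j: "y [^] j \<in> B" for j
  proof -
    have "int p ^ s dvd j" if "s \<le> Suc k" for s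
      using that
    proof (induction s)
      case (Suc s)
      then obtain u where u: "j = int p ^ s * u" by auto
      have "z [^] u = (y [^] j) [^] (int p ^ (k - s))"
        using y Suc.prems by (simp add: zy u int_pow_pow mult_ac flip: power_add)
      also have "\<dots> \<in> B" using j by (rule subgroup_int_pow_closed[OF B])
      finally have "int p dvd u"
        using dvd_if_int_pow_mem[OF B p z(1) zB] z(3) B.one_closed by simp
      then show ?case by (simp add: u mult.commute[of "int p"] mult_dvd_mono)
    qed simp
    then show ?thesis by blast
  qed
  define i where "i x = (SOME i::int. x \<otimes> y [^] i \<in> B)" for x
  have i: "x \<otimes> y [^] i x \<in> B" if "x \<in> carrier G" for x
    unfolding i_def using ex[OF that] by (rule someI_ex)
  \<comment> \<open>The component of \<open>x\<close> in \<open>\<langle>y\<rangle>\<close> is \<open>y [^] (- i x)\<close>; the extra factor raises it to the power \<open>p\<close>.\<close>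
  define f where "f x = x \<otimes> y [^] ((1 - int p) * i x)" for x
  have hom: "f \<in> hom G G"
  proof (rule homI)
    show "f x \<in> carrier G" if "x \<in> carrier G" for x using that y by (simp add: f_def)
  next
    fix x x' assume x: "x \<in> carrier G" "x' \<in> carrier G"
    let ?d = "i (x \<otimes> x') - i x - i x'"
    have "inv ((x \<otimes> y [^] i x) \<otimes> (x' \<otimes> y [^] i x')) \<otimes> ((x \<otimes> x') \<otimes> y [^] i (x \<otimes> x')) \<in> B"
      using x by (intro B.m_closed B.m_inv_closed i) auto
    also have "inv ((x \<otimes> y [^] i x) \<otimes> (x' \<otimes> y [^] i x')) \<otimes> ((x \<otimes> x') \<otimes> y [^] i (x \<otimes> x')) = y [^] ?d"
      using x y by (simp add: int_pow_diff inv_mult_group m_ac inv_cancel_left cancel_inv_left)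
    finally obtain t where t: "i (x \<otimes> x') = i x + i x' + ?q * t"
      using yB[of ?d] by (metis add.commute add_diff_cancel_left' diff_diff_add diff_add_cancel dvdE)
    have "y [^] ((1 - int p) * i (x \<otimes> x')) =
        y [^] ((1 - int p) * i x + (1 - int p) * i x' + ?q * ((1 - int p) * t))"
      unfolding t by (rule arg_cong[where f = "\<lambda>n. y [^] (n::int)"]) (simp add: algebra_simps)
    also have "\<dots> = y [^] ((1 - int p) * i x) \<otimes> y [^] ((1 - int p) * i x')"
      using y yq by (simp add: int_pow_mult)
    finally show "f (x \<otimes> x') = f x \<otimes> f x'"
      using x y by (simp add: f_def m_ac)
  qed
  then interpret f: group_hom G G f by (simp add: group_hom_def group_hom_axioms_def)
  have fz: "f z = \<one>"
  proof -
    have "y [^] (int p ^ k + i z) \<in> B"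
      using i[OF z(1)] y by (simp add: int_pow_mult flip: zy)
    then obtain t where "int p ^ k + i z = ?q * t"
      using yB by blast
    then have iz: "i z = ?q * t - int p ^ k" by simp
    have "int p ^ k + (1 - int p) * i z = ?q * ((1 - int p) * t + 1)"
      unfolding iz by (simp add: algebra_simps)
    moreover have "f z = y [^] (int p ^ k + (1 - int p) * i z)"
      using y by (simp add: f_def int_pow_mult flip: zy)
    ultimately show ?thesis using yq by simp
  qed
  have "f x = \<one> \<longleftrightarrow> (\<exists>t::int. x = z [^] t)" if x: "x \<in> carrier G" for x
  proof
    assume "f x = \<one>"
    then have x_eq: "x = y [^] ((int p - 1) * i x)"
    proof -
      have "x = inv (y [^] ((1 - int p) * i x))"
        using \<open>f x = \<one>\<close> x y by (intro inv_equality[symmetric]) (auto simp: f_def)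
      also have "\<dots> = y [^] ((int p - 1) * i x)"
        using y by (simp add: algebra_simps flip: int_pow_neg)
      finally show ?thesis .
    qed
    have "x \<otimes> y [^] i x = y [^] ((int p - 1) * i x + i x)"
      using y by (subst x_eq) (simp add: int_pow_mult)
    then have "y [^] (int p * i x) \<in> B"
      using i[OF x] by (simp add: algebra_simps)
    then have "int p ^ k dvd i x"
      using yB[of "int p * i x"] prime_gt_0_nat[OF p] by simp
    then obtain t where "i x = int p ^ k * t" by blast
    then have "x = z [^] ((int p - 1) * t)"
      using y by (subst x_eq) (simp add: zy int_pow_pow mult_ac)
    then show "\<exists>t::int. x = z [^] t" by blast
  next
    assume "\<exists>t::int. x = z [^] t"
    then show "f x = \<one>" using fz z by (auto simp: f.hom_int_pow)
  qed
  then show ?thesis using hom by blast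
qed

text \<open>
  By induction on the order of \<open>N\<close>: kill an element of prime order in \<open>N\<close> first, and then the image of \<open>N\<close>, which is
  smaller.  Working with endomorphisms keeps the induction inside one group.
\<close>

lemma ex_endomorphism_with_kernel:
  assumes fin: "finite (carrier G)" and "subgroup N G"
  shows "\<exists>f\<in>hom G G. \<forall>x\<in>carrier G. f x = \<one> \<longleftrightarrow> x \<in> N"
  using assms(2)
proof (induction "card N" arbitrary: N rule: less_induct)
  case (less N)
  interpret N: subgroup N G by fact
  show ?case
  proof (cases "N = {\<one>}")
    case True
    then show ?thesis by (intro bexI[of _ "\<lambda>x. x"]) (auto simp: hom_def)
  next
    case False
    then obtain x where x: "x \<in> N" "x \<noteq> \<one>" using N.one_closed by blast
    have xc: "x \<in> carrier G" using x N.subset by blast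
    have "ord x \<noteq> 1" using x xc ord_eq_1 by simp
    then obtain p where p: "prime p" "p dvd ord x" using prime_factor_nat by blast
    then obtain m where m: "ord x = p * m" by blast
    define z where "z = x [^] m"
    have zN: "z \<in> N" unfolding z_def using x
      using subgroup_int_pow_closed[OF less.prems, of x "int m"] by (simp add: int_pow_int)
    have zc: "z \<in> carrier G" using xc by (simp add: z_def)
    have "ord x > 0" using ord_ge_1[OF fin xc] by simp
    then have z1: "z \<noteq> \<one>" unfolding z_def
      using m xc pow_eq_id[of x m] prime_gt_1_nat[OF p(1)] by (auto dest!: dvd_imp_le)
    have zp: "z [^] int p = \<one>"
      using xc pow_ord_eq_1[OF xc] m by (simp add: z_def int_pow_int nat_pow_pow mult.commute)
    obtain f where f: "f \<in> hom G G" and fk: "\<And>x. x \<in> carrier G \<Longrightarrow> f x = \<one> \<longleftrightarrow> (\<exists>t::int. x = z [^] t)"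
      using endomorphism_killing_prime_order[OF fin p(1) zc z1 zp] by blast
    interpret f: group_hom G G f using f by (simp add: group_hom_def group_hom_axioms_def)
    have finN: "finite N" using fin N.subset finite_subset by blast
    have fz: "f z = \<one>" using fk[OF zc] int_pow_1[OF zc] by metis
    have "\<not> inj_on f N"
      using fz z1 zN N.one_closed f.hom_one by (metis inj_onD)
    then have "card (f ` N) < card N"
      using finN by (metis card_image_le le_neq_implies_less inj_on_iff_eq_card)
    moreover have "subgroup (f ` N) G"
      using less.prems by (rule f.subgroup_img_is_subgroup)
    ultimately obtain g where g: "g \<in> hom G G" and gk: "\<And>x. x \<in> carrier G \<Longrightarrow> g x = \<one> \<longleftrightarrow> x \<in> f ` N"
      using less.hyps by blast
    have "g (f x) = \<one> \<longleftrightarrow> x \<in> N" if x: "x \<in> carrier G" for x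
    proof
      assume "g (f x) = \<one>"
      then obtain n where n: "n \<in> N" "f x = f n" using gk x by auto
      then have nc: "n \<in> carrier G" using N.subset by blast
      have "f (x \<otimes> inv n) = \<one>" using n x nc by simp
      then obtain t :: int where "x \<otimes> inv n = z [^] t" using fk[of "x \<otimes> inv n"] x nc by auto
      then have "x = z [^] t \<otimes> n" using x nc by (metis inv_closed inv_inv inv_solve_right int_pow_closed zc)
      then show "x \<in> N" using n zN subgroup_int_pow_closed[OF less.prems zN] by simp
    qed (use gk x in auto)
    moreover have "g \<circ> f \<in> hom G G" using f g by (rule Group.hom_compose)
    ultimately show ?thesis by (intro bexI[of _ "g \<circ> f"]) auto
  qed
qed

text \<open>
  The image of an endomorphism with the same kernel as \<open>h\<close> is the required subgroup.
\<close>

theorem epi_image_iso_subgroup: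
  assumes fin: "finite (carrier G)" and h: "h \<in> epi G Q" and Q: "group Q"
  shows "\<exists>K. subgroup K G \<and> Q \<cong> G\<lparr>carrier := K\<rparr>"
proof -
  interpret h: group_hom G Q h
    using h Q by (simp add: group_hom_def group_hom_axioms_def epi_def)
  obtain f where f: "f \<in> hom G G" and fk: "\<And>x. x \<in> carrier G \<Longrightarrow> f x = \<one> \<longleftrightarrow> x \<in> kernel G Q h"
    using ex_endomorphism_with_kernel[OF fin h.subgroup_kernel] by blast
  interpret f: group_hom G G f using f by (simp add: group_hom_def group_hom_axioms_def)
  let ?K = "f ` carrier G"
  have K: "subgroup ?K G" by (rule f.img_is_subgroup)
  interpret f': group_hom G "G\<lparr>carrier := ?K\<rparr>" f
    using f K subgroup_imp_group by (auto simp: group_hom_def group_hom_axioms_def hom_def)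
  have "kernel G (G\<lparr>carrier := ?K\<rparr>) f = kernel G Q h"
    using fk by (auto simp: kernel_def)
  then have "G Mod kernel G Q h \<cong> G\<lparr>carrier := ?K\<rparr>"
    using f'.FactGroup_iso by simp
  moreover have "G Mod kernel G Q h \<cong> Q"
    using h by (intro h.FactGroup_iso) (simp add: epi_def)
  ultimately have "Q \<cong> G\<lparr>carrier := ?K\<rparr>"
    by (meson group.iso_sym h.normal_kernel iso_trans normal.factorgroup_is_group)
  then show ?thesis using K by blast
qed

end

section \<open>Presented monoids\<close>

(* Words are handled through the rules for Cons and append; turning membership in lists L into a
   statement about set w would hide the hypotheses of the lemmas below. *)
declare in_listsI [rule del] in_listsD [rule del]

lemma word_cong_lists: "(u, v) \<in> word_cong L r \<Longrightarrow> u \<in> lists L \<and> v \<in> lists L"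
  by (induction rule: word_cong.induct) auto

lemma equiv_word_cong: "equiv (lists L) (word_cong L r)"
proof (rule equivI)
  show "word_cong L r \<subseteq> lists L \<times> lists L" using word_cong_lists[of _ _ L r] by auto
  show "refl_on (lists L) (word_cong L r)"
    by (auto simp: refl_on_def intro: word_cong.refl)
  show "sym (word_cong L r)" by (auto intro: symI word_cong.sym)
  show "trans (word_cong L r)" by (auto intro: transI word_cong.trans)
qed

lemma word_cong_context:
  assumes "(u, v) \<in> word_cong L r" "p \<in> lists L" "q \<in> lists L"
  shows "(p @ u @ q, p @ v @ q) \<in> word_cong L r"
  using assms
proof (induction rule: word_cong.induct)
  case (rel u v a b)
  then show ?case
    using word_cong.rel[of u v r L "p @ a" "b @ q"] by simp
qed (auto intro: word_cong.refl word_cong.sym word_cong.trans)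

lemma word_cong_append:
  assumes "(u, u') \<in> word_cong L r" "(v, v') \<in> word_cong L r"
  shows "(u @ v, u' @ v') \<in> word_cong L r"
  using word_cong_context[OF assms(1), of "[]" v] word_cong_context[OF assms(2), of u' "[]"]
    word_cong_lists[OF assms(1)] word_cong_lists[OF assms(2)]
  by (auto intro: word_cong.trans)

abbreviation word_class :: "'l set \<Rightarrow> ('l list \<times> 'l list) set \<Rightarrow> 'l list \<Rightarrow> 'l list set" where
  "word_class L r w \<equiv> word_cong L r `` {w}"

lemma word_class_eq_iff:
  "\<lbrakk>u \<in> lists L; v \<in> lists L\<rbrakk> \<Longrightarrow> word_class L r u = word_class L r v \<longleftrightarrow> (u, v) \<in> word_cong L r"
  using eq_equiv_class_iff[OF equiv_word_cong] .

lemma carrier_presented_monoid: "carrier (presented_monoid L r) = word_class L r ` lists L"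
  by (auto simp: presented_monoid_def quotient_def)

lemma word_class_mem: "w \<in> lists L \<Longrightarrow> word_class L r w \<in> carrier (presented_monoid L r)"
  by (simp add: carrier_presented_monoid)

lemma one_presented_monoid: "\<one>\<^bsub>presented_monoid L r\<^esub> = word_class L r []"
  by (simp add: presented_monoid_def)

lemma mult_word_class:
  assumes "u \<in> lists L" "v \<in> lists L"
  shows "word_class L r u \<otimes>\<^bsub>presented_monoid L r\<^esub> word_class L r v = word_class L r (u @ v)"
proof -
  have "word_class L r (u' @ v') = word_class L r (u @ v)"
    if "u' \<in> word_class L r u" "v' \<in> word_class L r v" for u' v'
  proof -
    have "(u @ v, u' @ v') \<in> word_cong L r" using that by (auto intro: word_cong_append)
    then show ?thesis using equiv_class_eq[OF equiv_word_cong] by metis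
  qed
  moreover have "u \<in> word_class L r u" "v \<in> word_class L r v"
    using assms by (auto intro: word_cong.refl)
  ultimately have "(\<Union>u'\<in>word_class L r u. \<Union>v'\<in>word_class L r v. word_class L r (u' @ v')) = word_class L r (u @ v)"
    by blast
  then show ?thesis by (simp add: presented_monoid_def)
qed

lemma monoid_presented_monoid: "monoid (presented_monoid L r)"
  by (rule monoidI) (auto simp: carrier_presented_monoid one_presented_monoid mult_word_class)

text \<open>
  A left inverse of a word is the concatenation of left inverses of its letters in reverse order.
\<close>

lemma group_presented_monoid:
  assumes "\<And>l. l \<in> L \<Longrightarrow> \<exists>v\<in>lists L. (v @ [l], []) \<in> word_cong L r"
  shows "group (presented_monoid L r)"
proof (rule monoid.group_l_invI[OF monoid_presented_monoid])
  fix x assume "x \<in> carrier (presented_monoid L r)"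
  then obtain w where w: "w \<in> lists L" "x = word_class L r w"
    by (auto simp: carrier_presented_monoid)
  have "\<exists>v\<in>lists L. (v @ w, []) \<in> word_cong L r"
    using w(1)
  proof (induction w)
    case Nil
    then show ?case by (auto intro: word_cong.refl)
  next
    case (Cons l w)
    then obtain v v' where v: "v \<in> lists L" "(v @ w, []) \<in> word_cong L r"
      "v' \<in> lists L" "(v' @ [l], []) \<in> word_cong L r" using assms by blast
    have "(v @ (v' @ [l]) @ w, v @ [] @ w) \<in> word_cong L r"
      using Cons.hyps v by (intro word_cong_context) auto
    then have "((v @ v') @ l # w, []) \<in> word_cong L r"
      using v by (auto intro: word_cong.trans)
    then show ?case using v by (intro bexI[of _ "v @ v'"]) auto
  qed
  then obtain v where v: "v \<in> lists L" "(v @ w, []) \<in> word_cong L r" by blast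
  then have "word_class L r v \<otimes>\<^bsub>presented_monoid L r\<^esub> x = \<one>\<^bsub>presented_monoid L r\<^esub>"
    using w by (simp add: mult_word_class one_presented_monoid word_class_eq_iff)
  then show "\<exists>y\<in>carrier (presented_monoid L r). y \<otimes>\<^bsub>presented_monoid L r\<^esub> x = \<one>\<^bsub>presented_monoid L r\<^esub>"
    using v word_class_mem by blast
qed

text \<open>
  This has the form of \<open>natural_map\<close>, for an arbitrary target group; it is a homomorphism as soon as the values of
  the letters satisfy the defining relations.
\<close>

definition induced_map :: "('g, 'm) monoid_scheme \<Rightarrow> ('l \<Rightarrow> 'g) \<Rightarrow> 'l list set \<Rightarrow> 'g" where
  "induced_map G f P = the_elem (word_value G f ` P)"

context group
begin

lemma word_value_cong:
  assumes f: "f ` L \<subseteq> carrier G"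
    and r: "\<And>u v. \<lbrakk>(u, v) \<in> r; u \<in> lists L; v \<in> lists L\<rbrakk> \<Longrightarrow> word_value G f u = word_value G f v"
    and "(u, v) \<in> word_cong L r"
  shows "word_value G f u = word_value G f v"
  using assms(3)
proof (induction rule: word_cong.induct)
  case (rel u v p q)
  then show ?case using f r by (simp add: word_value_append[OF f])
qed auto

lemma induced_map_word_class:
  assumes f: "f ` L \<subseteq> carrier G"
    and r: "\<And>u v. \<lbrakk>(u, v) \<in> r; u \<in> lists L; v \<in> lists L\<rbrakk> \<Longrightarrow> word_value G f u = word_value G f v"
    and w: "w \<in> lists L"
  shows "induced_map G f (word_class L r w) = word_value G f w"
proof -
  have "word_value G f ` word_class L r w = (\<lambda>_. word_value G f w) ` word_class L r w"
    using word_value_cong[OF f r] by (intro image_cong refl) (auto dest: word_cong.sym)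
  also have "\<dots> = {word_value G f w}"
    using word_cong.refl[OF w] by (intro image_constant) blast
  finally have "word_value G f ` word_class L r w = {word_value G f w}" .
  then show ?thesis by (simp add: induced_map_def)
qed

lemma induced_map_hom:
  assumes f: "f ` L \<subseteq> carrier G"
    and r: "\<And>u v. \<lbrakk>(u, v) \<in> r; u \<in> lists L; v \<in> lists L\<rbrakk> \<Longrightarrow> word_value G f u = word_value G f v"
  shows "induced_map G f \<in> hom (presented_monoid L r) G"
proof (rule homI)
  note ind = induced_map_word_class[OF f r]
  fix P assume "P \<in> carrier (presented_monoid L r)"
  then obtain u where u: "u \<in> lists L" "P = word_class L r u"
    unfolding carrier_presented_monoid by blast
  then show "induced_map G f P \<in> carrier G"
    using ind u(1) word_value_closed[OF f u(1)] by simp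
  fix Q assume "Q \<in> carrier (presented_monoid L r)"
  then obtain v where v: "v \<in> lists L" "Q = word_class L r v"
    unfolding carrier_presented_monoid by blast
  have "induced_map G f (word_class L r (u @ v)) = word_value G f u \<otimes> word_value G f v"
    using ind[where w = "u @ v"] u v word_value_append[OF f u(1) v(1)] by simp
  then show "induced_map G f (P \<otimes>\<^bsub>presented_monoid L r\<^esub> Q) = induced_map G f P \<otimes> induced_map G f Q"
    using ind u v by (simp add: mult_word_class)
qed

end

section \<open>Free groups are projective\<close>

lemma group_hom_inverse_iso:
  assumes "group F" "h \<in> iso F L"
  shows "\<exists>k\<in>hom L F. \<forall>x\<in>carrier F. k (h x) = x"
proof (rule bexI[of _ "inv_into (carrier F) h"])
  show "inv_into (carrier F) h \<in> hom L F"
    using group.iso_set_sym[OF assms] by (rule iso_imp_homomorphism)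
  show "\<forall>x\<in>carrier F. inv_into (carrier F) h (h x) = x"
    using assms(2) by (simp add: iso_def bij_betw_def)
qed

text \<open>
  Choose preimages of the values on the free basis and extend.  The comparison with \<open>\<phi>\<close> is made on the words of
  \<open>free_group X\<close>, where \<open>\<phi>\<close> becomes \<open>\<phi>'\<close>, and starts from the letters; the value of \<open>\<phi>'\<close> at an inverse letter is determined
  because the letter and its inverse cancel.
\<close>

theorem free_group_projective:
  fixes X :: "'x set"
  assumes F: "group F" and iso: "F \<cong> free_group X"
    and q: "group_hom Y Z q" and surj: "carrier Z \<subseteq> q ` carrier Y" and \<phi>: "group_hom F Z \<phi>"
  shows "\<exists>\<psi>. group_hom F Y \<psi> \<and> (\<forall>x\<in>carrier F. q (\<psi> x) = \<phi> x)"
proof -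
  interpret q: group_hom Y Z q by fact
  interpret \<phi>: group_hom F Z \<phi> by fact
  define L where "L = X \<times> (UNIV :: bool set)"
  define r where "r = {([(x, b), (x, \<not> b)], [] :: ('x \<times> bool) list) | x b. x \<in> X}"
  have FG: "free_group X = presented_monoid L r" by (simp add: free_group_def L_def r_def)
  have letters [simp]: "(x, b) \<in> L \<longleftrightarrow> x \<in> X" for x b by (simp add: L_def)
  obtain h where h: "h \<in> iso F (free_group X)" using iso by (auto simp: is_iso_def)
  then have hh: "h \<in> hom F (free_group X)" by (simp add: iso_def)
  obtain k where k: "k \<in> hom (free_group X) F" and kh: "\<And>x. x \<in> carrier F \<Longrightarrow> k (h x) = x"
    using group_hom_inverse_iso[OF F h] by blast
  define \<phi>' where "\<phi>' = \<phi> \<circ> k"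
  have \<phi>': "\<phi>' \<in> hom (free_group X) Z"
    unfolding \<phi>'_def using k \<phi>.homh by (rule Group.hom_compose)
  \<comment> \<open>The map \<open>\<phi>'\<close> preserves products, so its value at the empty word is an idempotent of the group \<open>Z\<close>.\<close>
  have \<phi>'1: "\<phi>' (word_class L r []) = \<one>\<^bsub>Z\<^esub>"
  proof -
    have e: "word_class L r [] \<in> carrier (free_group X)"
      unfolding FG by (rule word_class_mem) simp
    have "\<phi>' (word_class L r []) \<otimes>\<^bsub>Z\<^esub> \<phi>' (word_class L r []) = \<phi>' (word_class L r [])"
      using hom_mult[OF \<phi>' e e] by (simp add: FG mult_word_class)
    moreover have "\<phi>' (word_class L r []) \<in> carrier Z" using \<phi>' e by (rule hom_in_carrier)
    ultimately show ?thesis by simp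
  qed
  have \<phi>'_mult: "\<phi>' (word_class L r (u @ v)) = \<phi>' (word_class L r u) \<otimes>\<^bsub>Z\<^esub> \<phi>' (word_class L r v)"
    if "u \<in> lists L" "v \<in> lists L" for u v
    using hom_mult[OF \<phi>', of "word_class L r u" "word_class L r v"] that
    by (simp add: FG mult_word_class word_class_mem)
  have \<phi>'_closed: "\<phi>' (word_class L r u) \<in> carrier Z" if "u \<in> lists L" for u
    using \<phi>' that by (intro hom_in_carrier[OF \<phi>']) (simp add: FG word_class_mem)
  have "\<exists>y\<in>carrier Y. q y = \<phi>' (word_class L r [(x, True)])" if "x \<in> X" for x
  proof -
    have "\<phi>' (word_class L r [(x, True)]) \<in> carrier Z" using \<phi>'_closed that by simp
    then have "\<phi>' (word_class L r [(x, True)]) \<in> q ` carrier Y" using surj by (rule rev_subsetD)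
    then show ?thesis by (auto simp only: image_iff)
  qed
  then obtain y where y: "\<And>x. x \<in> X \<Longrightarrow> y x \<in> carrier Y"
    "\<And>x. x \<in> X \<Longrightarrow> q (y x) = \<phi>' (word_class L r [(x, True)])" by metis
  define f where "f = (\<lambda>(x, b). if b then y x else inv\<^bsub>Y\<^esub> y x)"
  have f: "f ` L \<subseteq> carrier Y" using y by (auto simp: f_def L_def)
  have rel: "word_value Y f u = word_value Y f v" if "(u, v) \<in> r" "u \<in> lists L" "v \<in> lists L" for u v
    using that y by (auto simp: f_def r_def)
  note ind = q.G.induced_map_hom[OF f rel] q.G.induced_map_word_class[OF f rel]
  have letter: "q (f l) = \<phi>' (word_class L r [l])" if l': "l \<in> L" for l
  proof -
    obtain x b where l: "l = (x, b)" and x: "x \<in> X" using l' by (cases l) auto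
    show ?thesis
    proof (cases b)
      case True
      then show ?thesis using y x by (simp add: f_def l)
    next
      case False
      have "(([] @ [(x, False), (x, True)] @ []), ([] @ [] @ [])) \<in> word_cong L r"
        using x by (intro word_cong.rel) (auto simp: r_def)
      then have "word_class L r ([(x, False)] @ [(x, True)]) = word_class L r []"
        using x by (subst word_class_eq_iff) auto
      then have "\<phi>' (word_class L r [(x, False)]) \<otimes>\<^bsub>Z\<^esub> \<phi>' (word_class L r [(x, True)]) = \<one>\<^bsub>Z\<^esub>"
        using \<phi>'_mult[of "[(x, False)]" "[(x, True)]"] \<phi>'1 x by simp
      then have "\<phi>' (word_class L r [(x, False)]) = inv\<^bsub>Z\<^esub> \<phi>' (word_class L r [(x, True)])"
        using x by (intro q.H.inv_equality[symmetric] \<phi>'_closed) auto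
      then show ?thesis using y x False by (simp add: f_def l)
    qed
  qed
  have "q (word_value Y f w) = \<phi>' (word_class L r w)" if "w \<in> lists L" for w
    using that
  proof (induction w)
    case Nil
    then show ?case by (simp add: \<phi>'1)
  next
    case (Cons l w)
    then have "q (word_value Y f (l # w)) = q (f l) \<otimes>\<^bsub>Z\<^esub> q (word_value Y f w)"
      using f q.G.word_value_closed[OF f Cons.hyps(2)] Cons.hyps(1) by (simp add: image_subset_iff)
    also have "\<dots> = \<phi>' (word_class L r (l # w))"
      using letter[of l] Cons \<phi>'_mult[of "[l]" w] by simp
    finally show ?case .
  qed
  then have *: "q (induced_map Y f P) = \<phi>' P" if "P \<in> carrier (free_group X)" for P
    using that ind(2) by (auto simp: FG carrier_presented_monoid)
  have "induced_map Y f \<circ> h \<in> hom F Y"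
    using hh ind(1) by (auto simp: FG intro: Group.hom_compose)
  moreover have "q ((induced_map Y f \<circ> h) x) = \<phi> x" if "x \<in> carrier F" for x
    using *[OF hom_in_carrier[OF hh that]] kh[OF that] by (simp add: \<phi>'_def)
  ultimately show ?thesis
    by (auto simp: group_hom_def group_hom_axioms_def F q.G.group_axioms)
qed

section \<open>Free products\<close>

locale group_family =
  fixes I :: "'i set" and A :: "'i \<Rightarrow> ('a, 'm) monoid_scheme"
  assumes group_family: "i \<in> I \<Longrightarrow> group (A i)"
begin

abbreviation "letters \<equiv> SIGMA i:I. carrier (A i)"

abbreviation "relations \<equiv> {([(i, \<one>\<^bsub>A i\<^esub>)], []) | i. i \<in> I} \<union>
        {([(i, a), (i, b)], [(i, a \<otimes>\<^bsub>A i\<^esub> b)]) | i a b.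
           i \<in> I \<and> a \<in> carrier (A i) \<and> b \<in> carrier (A i)}"

lemma free_product_eq: "free_product I A = presented_monoid letters relations"
  by (simp add: free_product_def)

definition factor_inclusion :: "'i \<Rightarrow> 'a \<Rightarrow> ('i \<times> 'a) list set" where
  "factor_inclusion i a = word_class letters relations [(i, a)]"

definition single :: "'i \<Rightarrow> 'a \<Rightarrow> 'i \<Rightarrow> 'a" where
  "single i a = (\<lambda>j\<in>I. if j = i then a else \<one>\<^bsub>A j\<^esub>)"

lemma one_mem: "i \<in> I \<Longrightarrow> \<one>\<^bsub>A i\<^esub> \<in> carrier (A i)"
  by (simp add: group_family group.is_monoid)

lemma mult_mem: "\<lbrakk>i \<in> I; a \<in> carrier (A i); b \<in> carrier (A i)\<rbrakk> \<Longrightarrow> a \<otimes>\<^bsub>A i\<^esub> b \<in> carrier (A i)"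
  by (simp add: group_family group.is_monoid monoid.m_closed)

lemma letter_mult:
  "\<lbrakk>i \<in> I; a \<in> carrier (A i); b \<in> carrier (A i)\<rbrakk> \<Longrightarrow>
     ([(i, a), (i, b)], [(i, a \<otimes>\<^bsub>A i\<^esub> b)]) \<in> word_cong letters relations"
  using word_cong.rel[of "[(i, a), (i, b)]" "[(i, a \<otimes>\<^bsub>A i\<^esub> b)]" relations letters "[]" "[]"]
  by (auto simp: mult_mem)

lemma letter_one: "i \<in> I \<Longrightarrow> ([(i, \<one>\<^bsub>A i\<^esub>)], []) \<in> word_cong letters relations"
  using word_cong.rel[of "[(i, \<one>\<^bsub>A i\<^esub>)]" "[]" relations letters "[]" "[]"]
  by (auto simp: one_mem)

lemma group_free_product: "group (free_product I A)"
  unfolding free_product_eq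
proof (rule group_presented_monoid)
  fix l assume "l \<in> letters"
  then obtain i a where l: "l = (i, a)" "i \<in> I" "a \<in> carrier (A i)" by auto
  interpret group "A i" using l group_family by simp
  have "([(i, inv\<^bsub>A i\<^esub> a), (i, a)], []) \<in> word_cong letters relations"
    using word_cong.trans[OF letter_mult[of i "inv\<^bsub>A i\<^esub> a" a]] letter_one l by simp
  then show "\<exists>v\<in>lists letters. (v @ [l], []) \<in> word_cong letters relations"
    using l by (intro bexI[of _ "[(i, inv\<^bsub>A i\<^esub> a)]"]) auto
qed

lemma factor_inclusion_hom:
  assumes "i \<in> I"
  shows "group_hom (A i) (free_product I A) (factor_inclusion i)"
proof -
  have "factor_inclusion i \<in> hom (A i) (free_product I A)"
    using assms
    by (intro homI) (auto simp: free_product_eq factor_inclusion_def mult_word_class mult_mem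
        word_class_eq_iff letter_mult intro!: word_class_mem intro: word_cong.sym)
  then show ?thesis
    using assms by (simp add: group_hom_def group_hom_axioms_def group_family group_free_product)
qed

lemma single_mem: "\<lbrakk>i \<in> I; a \<in> carrier (A i)\<rbrakk> \<Longrightarrow> single i a \<in> carrier (sum_group I A)"
  by (auto simp: carrier_sum_group group_family single_def one_mem intro: rev_finite_subset[of "{i}"])

lemma natural_map_eq: "natural_map I A = induced_map (sum_group I A) (\<lambda>(i, a). single i a)"
  by (simp add: natural_map_def induced_map_def single_def fun_eq_iff)

lemma group_sum: "group (sum_group I A)"
  by (simp add: group_family)

lemma single_respects:
  assumes "(u, v) \<in> relations"
  shows "word_value (sum_group I A) (\<lambda>(i, a). single i a) u = word_value (sum_group I A) (\<lambda>(i, a). single i a) v"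
proof -
  interpret S: group "sum_group I A" by (rule group_sum)
  have [simp]: "single i a \<in> carrier (sum_group I A)" if "i \<in> I" "a \<in> carrier (A i)" for i a
    using that by (rule single_mem)
  have 1: "single i \<one>\<^bsub>A i\<^esub> = \<one>\<^bsub>sum_group I A\<^esub>" for i
    by (auto simp: single_def)
  have 2: "single i a \<otimes>\<^bsub>sum_group I A\<^esub> single i b = single i (a \<otimes>\<^bsub>A i\<^esub> b)"
    if "i \<in> I" for i a b
    using group_family by (auto simp: single_def group.is_monoid one_mem fun_eq_iff)
  show ?thesis
    using assms 1 2 by (auto simp: one_mem mult_mem simp del: one_sum_group mult_sum_group)
qed

lemma natural_map_hom: "group_hom (free_product I A) (sum_group I A) (natural_map I A)"
proof -
  interpret S: group "sum_group I A" by (rule group_sum)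
  have "natural_map I A \<in> hom (free_product I A) (sum_group I A)"
    unfolding natural_map_eq free_product_eq
    using single_respects by (intro S.induced_map_hom) (auto simp: single_mem)
  then show ?thesis
    by (simp add: group_hom_def group_hom_axioms_def group_free_product S.group_axioms)
qed

lemma natural_map_factor_inclusion:
  assumes "i \<in> I" "a \<in> carrier (A i)"
  shows "natural_map I A (factor_inclusion i a) = single i a"
proof -
  interpret S: group "sum_group I A" by (rule group_sum)
  show ?thesis
    unfolding natural_map_eq factor_inclusion_def
    using single_respects assms
    by (subst S.induced_map_word_class) (auto simp: single_mem simp del: one_sum_group mult_sum_group)
qed

end

section \<open>Verbal subgroups and varieties of countable groups\<close>

lemma (in group) law_value_closed:
  "range x \<subseteq> carrier G \<Longrightarrow> law_value G x w \<in> carrier G"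
  unfolding law_value_def by (rule word_value_closed[of _ UNIV]) (auto simp: image_subset_iff)

lemma (in group_hom) hom_law_value:
  assumes "range x \<subseteq> carrier G"
  shows "h (law_value G x w) = law_value H (h \<circ> x) w"
proof (induction w)
  case Nil
  then show ?case by (simp add: law_value_def word_value_def)
next
  case (Cons l w)
  obtain n b where l: "l = (n, b)" by fastforce
  have "x n \<in> carrier G" using assms by blast
  then show ?case
    using Cons G.law_value_closed[OF assms, of w]
    by (cases b) (simp_all add: law_value_def l)
qed

lemma (in group) subgroup_verbal: "subgroup (verbal_subgroup G V) G"
  unfolding verbal_subgroup_def using law_value_closed by (intro generate_is_subgroup) blast

lemma (in group_hom) hom_verbal_subgroup:
  "h ` verbal_subgroup G V \<subseteq> verbal_subgroup H V"
proof -
  have "h ` verbal_subgroup G V = generate H (h ` {law_value G x w | x w. range x \<subseteq> carrier G \<and> w \<in> V})"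
    unfolding verbal_subgroup_def using G.law_value_closed by (intro generate_img[symmetric]) blast
  also have "\<dots> \<subseteq> verbal_subgroup H V"
    unfolding verbal_subgroup_def
  proof (rule H.mono_generate, clarify)
    fix x :: "nat \<Rightarrow> 'a" and w assume "range x \<subseteq> carrier G" "w \<in> V"
    then show "\<exists>x' w'. h (law_value G x w) = law_value H x' w' \<and> range x' \<subseteq> carrier H \<and> w' \<in> V"
      by (intro exI[of _ "h \<circ> x"] exI[of _ w]) (auto simp: hom_law_value image_subset_iff)
  qed
  finally show ?thesis .
qed

lemma (in group) conjugation_hom:
  assumes "g \<in> carrier G"
  shows "group_hom G G (\<lambda>x. g \<otimes> x \<otimes> inv g)"
  using assms by (auto simp: group_hom_def group_hom_axioms_def hom_def word_simps)

lemma (in group) normal_verbal: "verbal_subgroup G V \<lhd> G"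
proof (rule normal_invI[OF subgroup_verbal])
  fix g x assume "g \<in> carrier G" "x \<in> verbal_subgroup G V"
  then show "g \<otimes> x \<otimes> inv g \<in> verbal_subgroup G V"
    using group_hom.hom_verbal_subgroup[OF conjugation_hom, of g V] by blast
qed

lemma variety_if_inj_hom:
  assumes h: "group_hom G H h" and inj: "inj_on h (carrier G)" and H: "H \<in> variety V"
  shows "G \<in> variety V"
proof -
  interpret h: group_hom G H h by fact
  have "law_value G x w = \<one>\<^bsub>G\<^esub>" if w: "w \<in> V" and x: "range x \<subseteq> carrier G" for w x
  proof -
    have "law_value H (h \<circ> x) w = \<one>\<^bsub>H\<^esub>"
      using H w x by (simp add: variety_def image_subset_iff)
    then have "h (law_value G x w) = h \<one>\<^bsub>G\<^esub>" using x by (simp add: h.hom_law_value)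
    then show ?thesis using inj x h.G.law_value_closed by (simp add: inj_on_def)
  qed
  then show ?thesis by (simp add: variety_def h.G.group_axioms)
qed

lemma (in group) normal_lower_central: "iterated_commutator G (carrier G) n \<lhd> G"
  by (intro normal_iterated_commutator normal_self)

lemma nilpotent_variety_if_inj_hom:
  assumes h: "group_hom G H h" and inj: "inj_on h (carrier G)" and H: "H \<in> nilpotent_variety c"
  shows "G \<in> nilpotent_variety c"
proof -
  interpret h: group_hom G H h by fact
  have "x = \<one>\<^bsub>G\<^esub>" if x: "x \<in> iterated_commutator G (carrier G) c" for x
  proof -
    have "h x = h \<one>\<^bsub>G\<^esub>"
      using h.hom_lower_central[OF x] H by (simp add: nilpotent_variety_def lower_central_def)
    moreover have "x \<in> carrier G" using x h.G.normal_subset[OF h.G.normal_lower_central] by blast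
    ultimately show ?thesis using inj by (simp add: inj_on_def)
  qed
  moreover have "\<one>\<^bsub>G\<^esub> \<in> iterated_commutator G (carrier G) c"
    by (intro subgroup.one_closed normal_imp_subgroup h.G.normal_lower_central)
  ultimately have "iterated_commutator G (carrier G) c = {\<one>\<^bsub>G\<^esub>}" by blast
  then show ?thesis
    by (simp add: nilpotent_variety_def lower_central_def h.G.group_axioms)
qed

text \<open>
  Inclusions between varieties are given for groups with carrier in \<open>nat\<close> only.  Every countable group has a
  copy there; the two injective homomorphisms carry membership in a variety in both directions.
\<close>

lemma countable_group_iso_nat:
  assumes "group G" and "countable (carrier G)"
  shows "\<exists>N :: nat monoid. \<exists>h k. group_hom G N h \<and> inj_on h (carrier G) \<and> group_hom N G k \<and> inj_on k (carrier N)"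
proof -
  interpret group G by fact
  let ?f = "to_nat_on (carrier G)"
  let ?g = "inv_into (carrier G) ?f"
  have inj: "inj_on ?f (carrier G)" using assms(2) by (rule inj_on_to_nat_on)
  define N where "N = \<lparr>carrier = ?f ` carrier G, monoid.mult = (\<lambda>a b. ?f (?g a \<otimes>\<^bsub>G\<^esub> ?g b)), one = ?f \<one>\<^bsub>G\<^esub>\<rparr>"
  have hom: "?f \<in> hom G N"
    using inj by (auto simp: hom_def N_def)
  have iso: "?f \<in> iso G N"
    using hom inj by (simp add: iso_def bij_betw_def N_def)
  have "group (N\<lparr>carrier := ?f ` carrier G, one := ?f \<one>\<^bsub>G\<^esub>\<rparr>)"
    using hom by (rule hom_imp_img_group)
  then have N: "group N" by (simp add: N_def)
  have "?g \<in> iso N G"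
    using iso by (rule iso_set_sym)
  then have "group_hom N G ?g" "inj_on ?g (carrier N)"
    using N by (auto simp: group_hom_def group_hom_axioms_def iso_def bij_betw_def)
  moreover have "group_hom G N ?f"
    using hom N by (simp add: group_hom_def group_hom_axioms_def)
  ultimately show ?thesis
    using inj by (intro exI[of _ N] exI[of _ ?f] exI[of _ ?g] conjI)
qed

lemma nilpotent_subvariety_countable:
  assumes "(nilpotent_variety c :: nat monoid set) \<subseteq> variety V"
    and "G \<in> nilpotent_variety c" "countable (carrier G)"
  shows "G \<in> variety V"
proof -
  have "group G" using assms(2) by (simp add: nilpotent_variety_def)
  then obtain N :: "nat monoid" and h k where N: "group_hom G N h" "inj_on h (carrier G)"
      "group_hom N G k" "inj_on k (carrier N)"
    using countable_group_iso_nat[OF _ assms(3)] by blast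
  have "N \<in> nilpotent_variety c" using N(3,4) assms(2) by (rule nilpotent_variety_if_inj_hom)
  then have "N \<in> variety V" using assms(1) by blast
  with N(1,2) show ?thesis by (rule variety_if_inj_hom)
qed

lemma subvariety_nilpotent_countable:
  assumes "(variety V :: nat monoid set) \<subseteq> nilpotent_variety c"
    and "G \<in> variety V" "countable (carrier G)"
  shows "G \<in> nilpotent_variety c"
proof -
  have "group G" using assms(2) by (simp add: variety_def)
  then obtain N :: "nat monoid" and h k where N: "group_hom G N h" "inj_on h (carrier G)"
      "group_hom N G k" "inj_on k (carrier N)"
    using countable_group_iso_nat[OF _ assms(3)] by blast
  have "N \<in> variety V" using N(3,4) assms(2) by (rule variety_if_inj_hom)
  then have "N \<in> nilpotent_variety c" using assms(1) by blast
  with N(1,2) show ?thesis by (rule nilpotent_variety_if_inj_hom)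
qed

lemma (in group) countable_generate:
  assumes "countable T" "T \<subseteq> carrier G"
  shows "countable (generate G T)"
proof -
  let ?S = "T \<union> m_inv G ` T"
  have "generate G T \<subseteq> generate G ?S" by (rule mono_generate[OF Un_upper1])
  also have "\<dots> \<subseteq> word_value G (\<lambda>x. x) ` lists ?S"
  proof (rule generate_subset_word_values)
    show "?S \<subseteq> carrier G" using assms(2) by auto
    show "inv s \<in> ?S" if s: "s \<in> ?S" for s
    proof (cases "s \<in> T")
      case False
      then obtain t where "t \<in> T" "s = inv t" using s by blast
      then show ?thesis using assms(2) by (simp add: subsetD)
    qed simp
  qed
  finally show ?thesis
    by (rule countable_subset) (use assms(1) in simp)
qed

abbreviation generated_group :: "('g, 'm) monoid_scheme \<Rightarrow> 'g set \<Rightarrow> ('g, 'm) monoid_scheme" where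
  "generated_group G T \<equiv> G\<lparr>carrier := generate G T\<rparr>"

lemma (in group) inclusion_generated_group:
  assumes "T \<subseteq> carrier G"
  shows "group_hom (generated_group G T) G (\<lambda>x. x)"
  using subgroup_imp_group[OF generate_is_subgroup[OF assms]] generate_incl[OF assms]
  by (auto simp: group_hom_def group_hom_axioms_def hom_def)

lemma (in group) inclusion_generated_groups:
  assumes "T \<subseteq> T'" "T' \<subseteq> carrier G"
  shows "group_hom (generated_group G T) (generated_group G T') (\<lambda>x. x)"
proof -
  have "group (generated_group G T)" "group (generated_group G T')"
    using assms by (simp_all add: subgroup_imp_group generate_is_subgroup)
  moreover have "generate G T \<subseteq> generate G T'" using assms(1) by (rule mono_generate)
  ultimately show ?thesis by (auto simp: group_hom_def group_hom_axioms_def hom_def)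
qed

text \<open>
  Unions of two countable sets suffice throughout: an element of \<open>\<gamma>\<^bsub>n+1\<^esub>\<close> in the subgroup generated by \<open>T\<close> stays in
  \<open>\<gamma>\<^bsub>n+1\<^esub>\<close> when \<open>T\<close> grows, so the supports of the parts of a product or commutator can be united.
\<close>

lemma (in group) lower_central_countable_support:
  assumes "x \<in> iterated_commutator G (carrier G) n"
  shows "\<exists>T. countable T \<and> T \<subseteq> carrier G \<and>
    x \<in> iterated_commutator (generated_group G T) (generate G T) n"
  using assms
proof (induction n arbitrary: x)
  case 0
  then show ?case
    by (intro exI[of _ "{x}"]) (auto intro: generate.incl)
next
  case (Suc n)
  let ?\<Gamma> = "\<lambda>T. iterated_commutator (generated_group G T) (generate G T)"
  let ?L = "{x \<in> carrier G. \<exists>T. countable T \<and> T \<subseteq> carrier G \<and> x \<in> ?\<Gamma> T (Suc n)}"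
  have gr: "group (generated_group G T)" if "T \<subseteq> carrier G" for T
    using that by (intro subgroup_imp_group generate_is_subgroup)
  have sub: "subgroup (?\<Gamma> T n) G" if "T \<subseteq> carrier G" for T n
  proof -
    have "subgroup (?\<Gamma> T n) (generated_group G T)"
      using group.normal_lower_central[OF gr[OF that]] by (auto intro: normal_imp_subgroup)
    from group_hom.subgroup_img_is_subgroup[OF inclusion_generated_group[OF that] this]
    show ?thesis by simp
  qed
  have mono: "?\<Gamma> T n \<subseteq> ?\<Gamma> T' n" if "T \<subseteq> T'" "T' \<subseteq> carrier G" for T T' n
    using group_hom.hom_lower_central[OF inclusion_generated_groups[OF that]] by auto
  have L: "subgroup ?L G"
  proof (rule subgroupI)
    show "?L \<subseteq> carrier G" by (rule Collect_restrict)
  next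
    have "\<one> \<in> ?L"
      by (intro CollectI conjI one_closed exI[of _ "{}"] empty_subsetI countable_empty subgroup.one_closed[OF sub])
    then show "?L \<noteq> {}" by (rule ex_in_conv[THEN iffD1, OF exI])
  next
    fix x assume "x \<in> ?L"
    then obtain T where T: "x \<in> carrier G" "countable T" "T \<subseteq> carrier G" "x \<in> ?\<Gamma> T (Suc n)" by blast
    have "inv x \<in> ?\<Gamma> T (Suc n)"
      using sub[OF T(3)] T(4) by (rule subgroup.m_inv_closed)
    with T show "inv x \<in> ?L" by (intro CollectI conjI inv_closed exI[of _ T])
  next
    fix x y assume "x \<in> ?L" "y \<in> ?L"
    then obtain T U where T: "x \<in> carrier G" "countable T" "T \<subseteq> carrier G" "x \<in> ?\<Gamma> T (Suc n)"
      and U: "y \<in> carrier G" "countable U" "U \<subseteq> carrier G" "y \<in> ?\<Gamma> U (Suc n)" by blast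
    have TU: "T \<union> U \<subseteq> carrier G" "countable (T \<union> U)" using T U by auto
    have "x \<otimes> y \<in> ?\<Gamma> (T \<union> U) (Suc n)"
      by (rule subgroup.m_closed[OF sub[OF TU(1)] subsetD[OF mono[OF Un_upper1 TU(1)] T(4)]
            subsetD[OF mono[OF Un_upper2 TU(1)] U(4)]])
    with T(1) U(1) TU show "x \<otimes> y \<in> ?L" by (intro CollectI conjI m_closed exI[of _ "T \<union> U"])
  qed
  have "commutator G k y \<in> ?L"
    if k: "k \<in> iterated_commutator G (carrier G) n" and y: "y \<in> carrier G" for k y
  proof -
    obtain T where T: "countable T" "T \<subseteq> carrier G" "k \<in> ?\<Gamma> T n" using Suc.IH[OF k] by blast
    let ?U = "insert y T"
    have U: "?U \<subseteq> carrier G" using T y by blast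
    interpret i: group_hom "generated_group G ?U" G "\<lambda>x. x" by (rule inclusion_generated_group[OF U])
    have kU: "k \<in> ?\<Gamma> ?U n" using mono[OF _ U] T by blast
    have yU: "y \<in> generate G ?U" by (auto intro: generate.incl)
    have "commutator (generated_group G ?U) k y \<in> ?\<Gamma> ?U (Suc n)"
      using i.G.commutator_mem[OF kU yU] by simp
    moreover have "k \<in> generate G ?U"
      using i.G.normal_subset[OF i.G.normal_lower_central] kU by fastforce
    ultimately have *: "commutator G k y \<in> ?\<Gamma> ?U (Suc n)"
      using i.hom_commutator[of k y] yU by simp
    have "commutator G k y \<in> carrier G" by (rule subsetD[OF subgroup.subset[OF sub[OF U]] *])
    moreover have "countable ?U" using T by simp
    ultimately show ?thesis using * U by (intro CollectI conjI exI[of _ ?U])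
  qed
  then have "iterated_commutator G (carrier G) (Suc n) \<subseteq> ?L"
    unfolding iterated_commutator.simps(2)[of G] by (intro commutator_subgroup_least[OF L])
  then have "x \<in> ?L" using Suc.prems by (rule subsetD)
  then show ?case by (simp only: mem_Collect_eq)
qed

text \<open>
  The lower central series of a quotient is the image of that of the group, which is \<open>lower_central_lift\<close> with
  the trivial subgroup in place of \<open>N\<close>.
\<close>

lemma (in group) nilpotent_quotient:
  "G Mod iterated_commutator G (carrier G) c \<in> nilpotent_variety c"
proof -
  let ?N = "iterated_commutator G (carrier G) c"
  interpret q: group_hom G "G Mod ?N" "\<lambda>x. ?N #> x"
    by (rule group_hom_coset[OF normal_lower_central])
  have 1: "{\<one>\<^bsub>G Mod ?N\<^esub>} \<lhd> G Mod ?N" by (rule q.H.one_is_normal)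
  have it: "iterated_commutator (G Mod ?N) {\<one>\<^bsub>G Mod ?N\<^esub>} c = {\<one>\<^bsub>G Mod ?N\<^esub>}"
    using q.H.iterated_commutator_subset[OF 1, of c]
      subgroup.one_closed[OF normal_imp_subgroup[OF q.H.normal_iterated_commutator[OF 1, of c]]] by blast
  have "y = \<one>\<^bsub>G Mod ?N\<^esub>" if y: "y \<in> iterated_commutator (G Mod ?N) (carrier (G Mod ?N)) c" for y
  proof -
    have yc: "y \<in> carrier (G Mod ?N)" using y q.H.normal_subset[OF q.H.normal_lower_central] by blast
    obtain x where x: "x \<in> ?N"
      "{\<one>\<^bsub>G Mod ?N\<^esub>} #>\<^bsub>G Mod ?N\<^esub> (?N #> x) = {\<one>\<^bsub>G Mod ?N\<^esub>} #>\<^bsub>G Mod ?N\<^esub> y"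
      using lower_central_lift[OF q.group_hom_axioms 1 _ y] it by (auto simp: carrier_FactGroup)
    have "x \<in> carrier G" using x normal_subset[OF normal_lower_central] by blast
    then have "?N #> x = \<one>\<^bsub>G Mod ?N\<^esub>" using coset_eq_one_iff[OF normal_lower_central] x by simp
    then show ?thesis using x(2) yc q.H.one_closed q.H.l_one by (simp add: r_coset_def)
  qed
  moreover have "\<one>\<^bsub>G Mod ?N\<^esub> \<in> iterated_commutator (G Mod ?N) (carrier (G Mod ?N)) c"
    by (intro subgroup.one_closed normal_imp_subgroup q.H.normal_lower_central)
  ultimately have "iterated_commutator (G Mod ?N) (carrier (G Mod ?N)) c = {\<one>\<^bsub>G Mod ?N\<^esub>}" by blast
  then show ?thesis
    by (simp add: nilpotent_variety_def lower_central_def q.H.group_axioms)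
qed

text \<open>
  Every assignment of variables in the quotient lifts to the group, and the value of a law at the lift lies in the
  verbal subgroup.
\<close>

lemma (in group) relatively_free_quotient: "G Mod verbal_subgroup G V \<in> variety V"
proof -
  let ?N = "verbal_subgroup G V"
  interpret q: group_hom G "G Mod ?N" "\<lambda>x. ?N #> x"
    by (rule group_hom_coset[OF normal_verbal])
  have "law_value (G Mod ?N) x w = \<one>\<^bsub>G Mod ?N\<^esub>" if w: "w \<in> V" and x: "range x \<subseteq> carrier (G Mod ?N)" for w x
  proof -
    have "\<exists>y\<in>carrier G. x n = ?N #> y" for n using x by (auto simp: carrier_FactGroup)
    then obtain y where y: "\<And>n. y n \<in> carrier G" "\<And>n. x n = ?N #> y n" by metis
    then have ry: "range y \<subseteq> carrier G" by blast
    have "x = (\<lambda>x. ?N #> x) \<circ> y" using y by (simp add: fun_eq_iff)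
    then have "law_value (G Mod ?N) x w = ?N #> law_value G y w"
      using q.hom_law_value[OF ry] by simp
    moreover have "law_value G y w \<in> ?N"
      unfolding verbal_subgroup_def using ry w by (intro generate.incl) blast
    ultimately show ?thesis
      using coset_eq_one_iff[OF normal_verbal law_value_closed[OF ry]] by simp
  qed
  then show ?thesis by (simp add: variety_def q.H.group_axioms)
qed

lemma countable_FactGroup: "countable (carrier G) \<Longrightarrow> countable (carrier (G Mod N))"
  by (simp add: carrier_FactGroup)

text \<open>
  The value of a law is computed in the subgroup \<open>B\<close> generated by the values of its variables.  This
  subgroup is countable, so its quotient \<open>B/\<gamma>\<^bsub>c+1\<^esub>(B)\<close>, being nilpotent of class at most \<open>c\<close>, satisfies
  the laws, and the value lies in \<open>\<gamma>\<^bsub>c+1\<^esub>(B)\<close>.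
\<close>

theorem (in group) verbal_subset_lower_central:
  assumes "(nilpotent_variety c :: nat monoid set) \<subseteq> variety V"
  shows "verbal_subgroup G V \<subseteq> iterated_commutator G (carrier G) c"
  unfolding verbal_subgroup_def
proof (rule generate_subgroup_incl)
  show "subgroup (iterated_commutator G (carrier G) c) G"
    using normal_lower_central by (rule normal_imp_subgroup)
  show "{law_value G x w | x w. range x \<subseteq> carrier G \<and> w \<in> V} \<subseteq> iterated_commutator G (carrier G) c"
  proof clarify
    fix x :: "nat \<Rightarrow> 'a" and w assume x: "range x \<subseteq> carrier G" and w: "w \<in> V"
    let ?B = "generated_group G (range x)"
    let ?\<Gamma> = "iterated_commutator ?B (carrier ?B) c"
    interpret i: group_hom ?B G "\<lambda>x. x" by (rule inclusion_generated_group[OF x])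
    interpret q: group_hom ?B "?B Mod ?\<Gamma>" "\<lambda>x. ?\<Gamma> #>\<^bsub>?B\<^esub> x"
      by (rule i.G.group_hom_coset[OF i.G.normal_lower_central])
    have xB: "range x \<subseteq> carrier ?B" by (auto intro: generate.incl)
    have "countable (range x)" by (intro countable_image countableI_type)
    then have "countable (carrier ?B)" using countable_generate[OF _ x] by simp
    then have "?B Mod ?\<Gamma> \<in> variety V"
      by (intro nilpotent_subvariety_countable[OF assms] i.G.nilpotent_quotient countable_FactGroup)
    then have law: "\<And>y. range y \<subseteq> carrier (?B Mod ?\<Gamma>) \<Longrightarrow> law_value (?B Mod ?\<Gamma>) y w = \<one>\<^bsub>?B Mod ?\<Gamma>\<^esub>"
      using w unfolding variety_def by blast
    have "law_value (?B Mod ?\<Gamma>) ((\<lambda>x. ?\<Gamma> #>\<^bsub>?B\<^esub> x) \<circ> x) w = \<one>\<^bsub>?B Mod ?\<Gamma>\<^esub>"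
    proof (rule law, rule image_subsetI)
      show "((\<lambda>x. ?\<Gamma> #>\<^bsub>?B\<^esub> x) \<circ> x) n \<in> carrier (?B Mod ?\<Gamma>)" for n
        unfolding comp_def using xB by (intro q.hom_closed) blast
    qed
    then have "?\<Gamma> #>\<^bsub>?B\<^esub> law_value ?B x w = ?\<Gamma>"
      by (simp only: q.hom_law_value[OF xB] one_FactGroup)
    then have "law_value ?B x w \<in> ?\<Gamma>"
      by (rule i.G.coset_eq_one_iff[OF i.G.normal_lower_central i.G.law_value_closed[OF xB], THEN iffD1])
    then have "law_value ?B x w \<in> iterated_commutator G (carrier G) c"
      by (rule i.hom_lower_central)
    then show "law_value G x w \<in> iterated_commutator G (carrier G) c"
      using i.hom_law_value[OF xB, of w] by (simp add: comp_def)
  qed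
qed

text \<open>
  An element of \<open>\<gamma>\<^bsub>c+1\<^esub>(G)\<close> lies in \<open>\<gamma>\<^bsub>c+1\<^esub>(B)\<close> for a countable subgroup \<open>B\<close>; the quotient \<open>B/V(B)\<close> belongs to the
  variety, hence is nilpotent of class at most \<open>c\<close>.
\<close>

theorem (in group) lower_central_subset_verbal:
  assumes "(variety V :: nat monoid set) \<subseteq> nilpotent_variety c"
  shows "iterated_commutator G (carrier G) c \<subseteq> verbal_subgroup G V"
proof
  fix g assume "g \<in> iterated_commutator G (carrier G) c"
  then obtain T where T: "countable T" "T \<subseteq> carrier G"
    and g: "g \<in> iterated_commutator (generated_group G T) (generate G T) c"
    using lower_central_countable_support by blast
  let ?B = "generated_group G T"
  let ?N = "verbal_subgroup ?B V"
  interpret i: group_hom ?B G "\<lambda>x. x" by (rule inclusion_generated_group[OF T(2)])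
  interpret q: group_hom ?B "?B Mod ?N" "\<lambda>x. ?N #>\<^bsub>?B\<^esub> x"
    by (rule i.G.group_hom_coset[OF i.G.normal_verbal])
  have "countable (carrier ?B)" using countable_generate[OF T] by simp
  then have "?B Mod ?N \<in> nilpotent_variety c"
    by (intro subvariety_nilpotent_countable[OF assms] i.G.relatively_free_quotient countable_FactGroup)
  moreover have gB: "g \<in> iterated_commutator ?B (carrier ?B) c" using g by simp
  ultimately have "?N #>\<^bsub>?B\<^esub> g = \<one>\<^bsub>?B Mod ?N\<^esub>"
    using q.hom_lower_central[OF gB] by (simp add: nilpotent_variety_def lower_central_def)
  moreover have "g \<in> carrier ?B" using gB i.G.normal_subset[OF i.G.normal_lower_central] by blast
  ultimately have "g \<in> ?N" using i.G.coset_eq_one_iff[OF i.G.normal_verbal] by simp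
  then show "g \<in> verbal_subgroup G V" using i.hom_verbal_subgroup by auto
qed

section \<open>Nilpotent multipliers\<close>

context group
begin

lemma subgroup_multiplier_numerator:
  "R \<lhd> G \<Longrightarrow> subgroup (R \<inter> iterated_commutator G (carrier G) c) G"
  by (intro subgroups_Inter_pair normal_imp_subgroup normal_lower_central)

lemma iterated_commutator_subset_lower_central:
  "R \<lhd> G \<Longrightarrow> iterated_commutator G R c \<subseteq> R \<inter> iterated_commutator G (carrier G) c"
  using iterated_commutator_subset iterated_commutator_mono[OF normal_subset normal_self] by blast

lemma normal_multiplier_denominator:
  assumes "R \<lhd> G"
  shows "iterated_commutator G R c \<lhd> G\<lparr>carrier := R \<inter> iterated_commutator G (carrier G) c\<rparr>"
  using assms by (intro normal_restrict_supergroup subgroup_multiplier_numerator normal_iterated_commutator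
      iterated_commutator_subset_lower_central)

lemma nilpotent_multiplier_eq:
  "nilpotent_multiplier c G R =
     (G\<lparr>carrier := R \<inter> iterated_commutator G (carrier G) c\<rparr>) Mod iterated_commutator G R c"
  by (simp add: nilpotent_multiplier_def lower_central_def)

lemma group_nilpotent_multiplier: "R \<lhd> G \<Longrightarrow> group (nilpotent_multiplier c G R)"
  unfolding nilpotent_multiplier_eq
  by (intro normal.factorgroup_is_group normal_multiplier_denominator)

lemma carrier_nilpotent_multiplier:
  "carrier (nilpotent_multiplier c G R) =
     (\<lambda>x. iterated_commutator G R c #> x) ` (R \<inter> iterated_commutator G (carrier G) c)"
  by (simp add: nilpotent_multiplier_eq carrier_FactGroup)

lemma one_nilpotent_multiplier: "\<one>\<^bsub>nilpotent_multiplier c G R\<^esub> = iterated_commutator G R c"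
  by (simp add: nilpotent_multiplier_eq)

lemma mult_nilpotent_multiplier:
  assumes "R \<lhd> G" "x \<in> carrier G" "y \<in> carrier G"
  shows "(iterated_commutator G R c #> x) \<otimes>\<^bsub>nilpotent_multiplier c G R\<^esub> (iterated_commutator G R c #> y) =
    iterated_commutator G R c #> (x \<otimes> y)"
  using assms by (simp add: nilpotent_multiplier_eq normal.rcos_sum normal_iterated_commutator)

lemma commutator_multiplier_numerator:
  assumes R: "R \<lhd> G" and "c \<ge> 1" and x: "x \<in> R" and y: "y \<in> iterated_commutator G (carrier G) c"
  shows "commutator G x y \<in> iterated_commutator G R c"
proof -
  obtain d where d: "c = Suc d" using assms(2) by (cases c) auto
  have "y \<in> iterated_commutator G (carrier G) d"
    using y iterated_commutator_Suc_subset[OF normal_self] d by blast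
  then show ?thesis
    using commutator_lower_central_mem[OF R x] d by blast
qed

text \<open>
  The commutator of \<open>x \<in> R\<close> and \<open>y \<in> \<gamma>\<^bsub>c+1\<^esub> \<subseteq> \<gamma>\<^sub>c\<close> lies in \<open>[R, \<gamma>\<^sub>c]\<close>, hence in \<open>[R, G, \<dots>, G]\<close> with \<open>c\<close> copies of \<open>G\<close>.
\<close>

theorem comm_group_nilpotent_multiplier:
  assumes R: "R \<lhd> G" and "c \<ge> 1"
  shows "comm_group (nilpotent_multiplier c G R)"
proof (rule group.group_comm_groupI[OF group_nilpotent_multiplier[OF R]])
  let ?D = "iterated_commutator G R c" and ?U = "R \<inter> iterated_commutator G (carrier G) c"
  have D: "?D \<lhd> G" using R by (rule normal_iterated_commutator)
  interpret q: group_hom G "G Mod ?D" "\<lambda>x. ?D #> x" by (rule group_hom_coset[OF D])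
  fix a b assume "a \<in> carrier (nilpotent_multiplier c G R)" "b \<in> carrier (nilpotent_multiplier c G R)"
  then obtain x y where a: "a = ?D #> x" "x \<in> ?U" and b: "b = ?D #> y" "y \<in> ?U"
    unfolding carrier_nilpotent_multiplier by blast
  have xy: "x \<in> carrier G" "y \<in> carrier G"
    using a b normal_subset[OF R] by auto
  have "?D #> commutator G x y = \<one>\<^bsub>G Mod ?D\<^esub>"
    using commutator_multiplier_numerator[OF R assms(2), of x y] a b coset_eq_one_iff[OF D] xy by simp
  then have "?D #> (x \<otimes> y) = ?D #> (y \<otimes> x)"
    using xy q.H.commutator_eq_one_iff[of "?D #> x" "?D #> y"]
    by (simp add: q.hom_commutator del: mult_FactGroup one_FactGroup)
  then show "a \<otimes>\<^bsub>nilpotent_multiplier c G R\<^esub> b = b \<otimes>\<^bsub>nilpotent_multiplier c G R\<^esub> a"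
    using a b R xy by (simp add: mult_nilpotent_multiplier)
qed

theorem finite_nilpotent_multiplier:
  assumes "R \<lhd> G" "finite (carrier (G Mod R))"
  shows "finite (carrier (nilpotent_multiplier c G R))"
  unfolding carrier_nilpotent_multiplier
  by (rule finite_subset[OF image_mono Baer_finite[OF assms]]) blast

end

lemma (in group_hom) coset_eq_hom:
  assumes "N \<lhd> G" "N' \<lhd> H" "h ` N \<subseteq> N'" "x \<in> carrier G" "y \<in> carrier G" "N #> x = N #> y"
  shows "N' #>\<^bsub>H\<^esub> h x = N' #>\<^bsub>H\<^esub> h y"
proof -
  have "x \<otimes> inv y \<in> N" using assms G.coset_eq_iff by blast
  then have "h (x \<otimes> inv y) \<in> N'" using assms(3) by blast
  then show ?thesis using assms H.coset_eq_iff[OF assms(2)] by simp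
qed

lemma free_presentation_epi:
  assumes "free_presentation F R G" "group G"
  shows "group F" "R \<lhd> F"
    "\<exists>\<phi>. group_hom F G \<phi> \<and> carrier G \<subseteq> \<phi> ` carrier F \<and> (\<forall>x\<in>carrier F. \<phi> x = \<one>\<^bsub>G\<^esub> \<longleftrightarrow> x \<in> R)"
proof -
  show F: "group F" and R: "R \<lhd> F" using assms(1) by (auto simp: free_presentation_def)
  interpret F: group F by fact
  interpret q: group_hom F "F Mod R" "\<lambda>x. R #>\<^bsub>F\<^esub> x" by (rule F.group_hom_coset[OF R])
  obtain k where k: "k \<in> iso (F Mod R) G"
    using assms(1) by (auto simp: free_presentation_def is_iso_def)
  have kh: "group_hom (F Mod R) G k"
    using k assms(2) q.H.group_axioms by (simp add: group_hom_def group_hom_axioms_def iso_def)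
  interpret k: group_hom "F Mod R" G k by fact
  have "carrier G \<subseteq> (k \<circ> (\<lambda>x. R #>\<^bsub>F\<^esub> x)) ` carrier F"
    using k by (auto simp: iso_def bij_betw_def carrier_FactGroup image_image)
  moreover have "(k \<circ> (\<lambda>x. R #>\<^bsub>F\<^esub> x)) x = \<one>\<^bsub>G\<^esub> \<longleftrightarrow> x \<in> R" if x: "x \<in> carrier F" for x
  proof -
    have "k (R #>\<^bsub>F\<^esub> x) = \<one>\<^bsub>G\<^esub> \<longleftrightarrow> R #>\<^bsub>F\<^esub> x = \<one>\<^bsub>F Mod R\<^esub>"
      using k k.inj_on_one_iff q.hom_closed[OF x] k.hom_one by (auto simp: iso_def bij_betw_def)
    then show ?thesis using F.coset_eq_one_iff[OF R x] by simp
  qed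
  ultimately show "\<exists>\<phi>. group_hom F G \<phi> \<and> carrier G \<subseteq> \<phi> ` carrier F \<and> (\<forall>x\<in>carrier F. \<phi> x = \<one>\<^bsub>G\<^esub> \<longleftrightarrow> x \<in> R)"
    using group_hom_compose[OF q.group_hom_axioms kh] by (intro exI[of _ "k \<circ> (\<lambda>x. R #>\<^bsub>F\<^esub> x)"]) simp
qed

lemma free_presentation_projective:
  assumes "free_presentation F R G"
    and "group_hom Y Z q" "carrier Z \<subseteq> q ` carrier Y" "group_hom F Z \<phi>"
  shows "\<exists>\<psi>. group_hom F Y \<psi> \<and> (\<forall>x\<in>carrier F. q (\<psi> x) = \<phi> x)"
  using assms free_group_projective unfolding free_presentation_def by metis

section \<open>Direct sums\<close>

lemma sum_group_projection:
  assumes "\<And>i. i \<in> I \<Longrightarrow> group (E i)" "i \<in> I"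
  shows "group_hom (sum_group I E) (E i) (\<lambda>e. e i)"
  using assms by (auto simp: group_hom_def group_hom_axioms_def hom_def carrier_sum_group)

text \<open>
  For surjectivity, the identity has to be lifted to the identity, so that the preimage has finite support.
\<close>

lemma sum_group_map_epi:
  assumes E: "\<And>i. i \<in> I \<Longrightarrow> group (E i)" and A: "\<And>i. i \<in> I \<Longrightarrow> group (A i)"
    and q: "\<And>i. i \<in> I \<Longrightarrow> group_hom (E i) (A i) (q i)"
    and surj: "\<And>i. i \<in> I \<Longrightarrow> carrier (A i) \<subseteq> q i ` carrier (E i)"
  shows "group_hom (sum_group I E) (sum_group I A) (\<lambda>e. \<lambda>i\<in>I. q i (e i))"
    and "carrier (sum_group I A) \<subseteq> (\<lambda>e. \<lambda>i\<in>I. q i (e i)) ` carrier (sum_group I E)"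
proof -
  have one: "q i \<one>\<^bsub>E i\<^esub> = \<one>\<^bsub>A i\<^esub>" if "i \<in> I" for i
    using q[OF that] by (rule group_hom.hom_one)
  have closed: "q i e \<in> carrier (A i)" if "i \<in> I" "e \<in> carrier (E i)" for i e
    using group_hom.hom_closed[OF q[OF that(1)] that(2)] .
  have mult: "q i (e \<otimes>\<^bsub>E i\<^esub> e') = q i e \<otimes>\<^bsub>A i\<^esub> q i e'"
    if "i \<in> I" "e \<in> carrier (E i)" "e' \<in> carrier (E i)" for i e e'
    using group_hom.hom_mult[OF q[OF that(1)] that(2,3)] .
  have "(\<lambda>e. \<lambda>i\<in>I. q i (e i)) \<in> hom (sum_group I E) (sum_group I A)"
  proof (rule homI)
    fix e assume e: "e \<in> carrier (sum_group I E)"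
    have "{i \<in> I. (\<lambda>i\<in>I. q i (e i)) i \<noteq> \<one>\<^bsub>A i\<^esub>} \<subseteq> {i \<in> I. e i \<noteq> \<one>\<^bsub>E i\<^esub>}"
      using one by auto
    then have "finite {i \<in> I. (\<lambda>i\<in>I. q i (e i)) i \<noteq> \<one>\<^bsub>A i\<^esub>}"
      using e by (simp add: carrier_sum_group E finite_subset)
    then show "(\<lambda>i\<in>I. q i (e i)) \<in> carrier (sum_group I A)"
      using e closed by (auto simp: carrier_sum_group E A)
  next
    fix e e' assume "e \<in> carrier (sum_group I E)" "e' \<in> carrier (sum_group I E)"
    then show "(\<lambda>i\<in>I. q i ((e \<otimes>\<^bsub>sum_group I E\<^esub> e') i)) =
        (\<lambda>i\<in>I. q i (e i)) \<otimes>\<^bsub>sum_group I A\<^esub> (\<lambda>i\<in>I. q i (e' i))"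
      using mult by (auto simp: carrier_sum_group E fun_eq_iff PiE_iff)
  qed
  then show "group_hom (sum_group I E) (sum_group I A) (\<lambda>e. \<lambda>i\<in>I. q i (e i))"
    by (simp add: group_hom_def group_hom_axioms_def E A)
  show "carrier (sum_group I A) \<subseteq> (\<lambda>e. \<lambda>i\<in>I. q i (e i)) ` carrier (sum_group I E)"
  proof
    fix a assume a: "a \<in> carrier (sum_group I A)"
    have "\<exists>x\<in>carrier (E i). q i x = a i \<and> (a i = \<one>\<^bsub>A i\<^esub> \<longrightarrow> x = \<one>\<^bsub>E i\<^esub>)" if i: "i \<in> I" for i
    proof (cases "a i = \<one>\<^bsub>A i\<^esub>")
      case True
      then show ?thesis using one i E by (intro bexI[of _ "\<one>\<^bsub>E i\<^esub>"]) (auto simp: group.is_monoid)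
    next
      case False
      have "a i \<in> carrier (A i)" using a i by (auto simp: carrier_sum_group A)
      then have "a i \<in> q i ` carrier (E i)" using surj[OF i] by blast
      then obtain x where "x \<in> carrier (E i)" "a i = q i x" by blast
      then show ?thesis using False by (intro bexI[of _ x]) simp_all
    qed
    then obtain e where e: "\<And>i. i \<in> I \<Longrightarrow> e i \<in> carrier (E i)" "\<And>i. i \<in> I \<Longrightarrow> q i (e i) = a i"
      "\<And>i. i \<in> I \<Longrightarrow> a i = \<one>\<^bsub>A i\<^esub> \<Longrightarrow> e i = \<one>\<^bsub>E i\<^esub>" by metis
    have "{i \<in> I. restrict e I i \<noteq> \<one>\<^bsub>E i\<^esub>} \<subseteq> {i \<in> I. a i \<noteq> \<one>\<^bsub>A i\<^esub>}" using e(3) by auto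
    then have "finite {i \<in> I. restrict e I i \<noteq> \<one>\<^bsub>E i\<^esub>}"
      using a by (simp add: carrier_sum_group A finite_subset)
    then have "restrict e I \<in> carrier (sum_group I E)"
      using e(1) by (auto simp: carrier_sum_group E)
    moreover have "a = (\<lambda>i\<in>I. q i (restrict e I i))"
      using a e(2) by (auto simp: carrier_sum_group A PiE_iff extensional_def fun_eq_iff)
    ultimately show "a \<in> (\<lambda>e. \<lambda>i\<in>I. q i (e i)) ` carrier (sum_group I E)"
      by (intro image_eqI[of a _ "restrict e I"])
  qed
qed

section \<open>The multiplier of a quotient of a free product\<close>

text \<open>
  The homomorphism \<open>\<Phi>\<close> on \<open>R \<inter> \<gamma>\<^bsub>c+1\<^esub>(F)\<close> sends \<open>x\<close> to the cosets of \<open>\<kappa> x\<close> and \<open>\<mu> x\<close>, where \<open>\<mu>\<close> lifts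
  \<open>F \<rightarrow> P/H\<close> to \<open>P\<close> and \<open>\<kappa>\<close> lifts the map from \<open>F\<close> to the direct product of the \<open>A i\<close> to that of the \<open>E i\<close>.  Lifting
  to the restricted direct product as a whole, not componentwise, is what makes the supports finite.  Since \<open>H\<close> dies in
  the direct product, \<open>\<kappa>\<close> maps \<open>R\<close> into the product of the \<open>S i\<close>.

  An element \<open>s\<close> of \<open>S j \<inter> \<gamma>\<^bsub>c+1\<^esub>(E j)\<close> is reached as follows.  Let \<open>\<theta> j : E j \<rightarrow> F\<close> lift \<open>E j \<rightarrow> A j \<rightarrow> P/H\<close>.  Then
  \<open>\<mu> \<circ> \<theta> j\<close> is congruent to \<open>E j \<rightarrow> A j \<rightarrow> P\<close> modulo \<open>H\<close>, the \<open>j\<close>-th component of \<open>\<kappa> \<circ> \<theta> j\<close> is congruent to the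
  identity modulo \<open>S j\<close>, and the \<open>i\<close>-th one for \<open>i \<noteq> j\<close> to the trivial map modulo \<open>S i\<close>.  By
  \<open>congruent_homs_on_lower_central\<close>, the image of \<open>\<theta> j s\<close> under \<open>\<Phi>\<close> is the class of \<open>s\<close> at position \<open>j\<close> and
  trivial elsewhere.  Finally, \<open>lower_central_lift\<close> for \<open>\<mu>\<close> reaches every class in the second factor, with a first
  component that can be corrected.
\<close>

theorem (in group_family) nilpotent_multiplier_epi:
  fixes E :: "'i \<Rightarrow> ('e, 'k) monoid_scheme" and F :: "('f, 'l) monoid_scheme"
  defines "P \<equiv> free_product I A"
  assumes H: "H \<lhd> P" and HC: "H \<subseteq> cartesian_subgroup I A"
    and ES: "\<And>i. i \<in> I \<Longrightarrow> free_presentation (E i) (S i) (A i)"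
    and FR: "free_presentation F R (P Mod H)"
  shows "\<exists>h. h \<in> epi (nilpotent_multiplier c F R)
    (sum_group I (\<lambda>i. nilpotent_multiplier c (E i) (S i)) \<times>\<times> nilpotent_multiplier c P H)"
proof -
  interpret P: group P unfolding P_def by (rule group_free_product)
  interpret qP: group_hom P "P Mod H" "\<lambda>x. H #>\<^bsub>P\<^esub> x" by (rule P.group_hom_coset[OF H])
  have F: "group F" and R: "R \<lhd> F" using free_presentation_epi[OF FR qP.H.group_axioms] by blast+
  interpret F: group F by fact
  obtain \<phi> where \<phi>_all: "group_hom F (P Mod H) \<phi> \<and> carrier (P Mod H) \<subseteq> \<phi> ` carrier F \<and>
      (\<forall>x\<in>carrier F. \<phi> x = \<one>\<^bsub>P Mod H\<^esub> \<longleftrightarrow> x \<in> R)"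
    using free_presentation_epi(3)[OF FR qP.H.group_axioms] by (rule exE)
  have \<phi>: "group_hom F (P Mod H) \<phi>" "carrier (P Mod H) \<subseteq> \<phi> ` carrier F" using \<phi>_all by simp_all
  have ker\<phi>: "\<phi> x = \<one>\<^bsub>P Mod H\<^esub> \<longleftrightarrow> x \<in> R" if "x \<in> carrier F" for x
    using \<phi>_all that by blast
  have E: "group (E i)" and S: "S i \<lhd> E i" if "i \<in> I" for i
    using free_presentation_epi[OF ES[OF that] group_family[OF that]] by blast+
  have "\<exists>q. group_hom (E i) (A i) q \<and> carrier (A i) \<subseteq> q ` carrier (E i) \<and>
      (\<forall>x\<in>carrier (E i). q x = \<one>\<^bsub>A i\<^esub> \<longleftrightarrow> x \<in> S i)" if "i \<in> I" for i
    using free_presentation_epi(3)[OF ES[OF that] group_family[OF that]] .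
  then obtain q where q: "\<And>i. i \<in> I \<Longrightarrow> group_hom (E i) (A i) (q i)"
    and q_surj: "\<And>i. i \<in> I \<Longrightarrow> carrier (A i) \<subseteq> q i ` carrier (E i)"
    and kerq: "\<And>i x. i \<in> I \<Longrightarrow> x \<in> carrier (E i) \<Longrightarrow> q i x = \<one>\<^bsub>A i\<^esub> \<longleftrightarrow> x \<in> S i"
    by metis
  note \<nu> = natural_map_hom[folded P_def]
  interpret \<nu>: group_hom P "sum_group I A" "natural_map I A" by (rule \<nu>)
  have "carrier (P Mod H) \<subseteq> (\<lambda>x. H #>\<^bsub>P\<^esub> x) ` carrier P" by (simp add: carrier_FactGroup)
  then obtain \<mu> where \<mu>: "group_hom F P \<mu>" and \<mu>\<phi>: "\<And>x. x \<in> carrier F \<Longrightarrow> H #>\<^bsub>P\<^esub> \<mu> x = \<phi> x"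
    using free_presentation_projective[OF FR qP.group_hom_axioms _ \<phi>(1)] by blast
  interpret \<mu>: group_hom F P \<mu> by (rule \<mu>)
  have R_iff: "x \<in> R \<longleftrightarrow> \<mu> x \<in> H" if "x \<in> carrier F" for x
    using ker\<phi>[OF that] P.coset_eq_one_iff[OF H, of "\<mu> x"] that by (simp add: \<mu>\<phi>)
  note \<sigma> = sum_group_map_epi[of I E A q, OF E group_family q q_surj]
  obtain \<kappa> where \<kappa>: "group_hom F (sum_group I E) \<kappa>"
    and \<kappa>\<nu>: "\<And>x. x \<in> carrier F \<Longrightarrow> (\<lambda>i\<in>I. q i (\<kappa> x i)) = (natural_map I A \<circ> \<mu>) x"
    using free_presentation_projective[OF FR \<sigma> group_hom_compose[OF \<mu> \<nu>]] by blast
  interpret \<kappa>: group_hom F "sum_group I E" \<kappa> by (rule \<kappa>)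
  have q\<kappa>: "q i (\<kappa> x i) = natural_map I A (\<mu> x) i" if "i \<in> I" "x \<in> carrier F" for i x
    using fun_cong[OF \<kappa>\<nu>[OF that(2)], of i] that(1) by simp
  have \<kappa>i: "group_hom F (E i) (\<lambda>x. \<kappa> x i)" if "i \<in> I" for i
    using group_hom_compose[OF \<kappa> sum_group_projection[of I E i]] E that by (simp add: comp_def)
  have "\<exists>\<theta>. group_hom (E i) F \<theta> \<and> (\<forall>x\<in>carrier (E i). \<phi> (\<theta> x) = H #>\<^bsub>P\<^esub> factor_inclusion i (q i x))"
    if i: "i \<in> I" for i
    using free_presentation_projective[OF ES[OF i] \<phi>
        group_hom_compose[OF group_hom_compose[OF q[OF i] factor_inclusion_hom[OF i, folded P_def]] qP.group_hom_axioms]]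
    by simp
  then obtain \<theta> where \<theta>: "\<And>i. i \<in> I \<Longrightarrow> group_hom (E i) F (\<theta> i)"
    and \<theta>\<phi>: "\<And>i x. i \<in> I \<Longrightarrow> x \<in> carrier (E i) \<Longrightarrow> \<phi> (\<theta> i x) = H #>\<^bsub>P\<^esub> factor_inclusion i (q i x)"
    by metis
  have \<mu>\<theta>: "H #>\<^bsub>P\<^esub> \<mu> (\<theta> i x) = H #>\<^bsub>P\<^esub> factor_inclusion i (q i x)" if "i \<in> I" "x \<in> carrier (E i)" for i x
    using \<theta>\<phi>[OF that] \<mu>\<phi> group_hom.hom_closed[OF \<theta>[OF that(1)] that(2)] by simp
  let ?D = "iterated_commutator F R c" and ?DP = "iterated_commutator P H c"
  let ?DE = "\<lambda>i. iterated_commutator (E i) (S i) c"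
  let ?\<Gamma> = "iterated_commutator F (carrier F) c"
  let ?MA = "sum_group I (\<lambda>i. nilpotent_multiplier c (E i) (S i))" and ?MP = "nilpotent_multiplier c P H"
  have D: "?D \<lhd> F" and DP: "?DP \<lhd> P" and DE: "?DE i \<lhd> E i" if "i \<in> I" for i
    using F.normal_iterated_commutator[OF R] P.normal_iterated_commutator[OF H]
      group.normal_iterated_commutator[OF E[OF that] S[OF that]] by blast+
  have [simp]: "\<And>i. i \<in> I \<Longrightarrow> group (nilpotent_multiplier c (E i) (S i))"
    using E S by (intro group.group_nilpotent_multiplier)
  have MA: "group ?MA" by simp
  have MP: "group ?MP" using H by (rule P.group_nilpotent_multiplier)
  have \<kappa>_S: "\<kappa> x i \<in> S i" if "i \<in> I" "x \<in> R" for i x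
  proof -
    have x: "x \<in> carrier F" using that(2) F.normal_subset[OF R] by blast
    have "\<mu> x \<in> cartesian_subgroup I A" using that(2) R_iff[OF x] HC by blast
    then have "natural_map I A (\<mu> x) = \<one>\<^bsub>sum_group I A\<^esub>" by (simp add: cartesian_subgroup_def kernel_def)
    then have "q i (\<kappa> x i) = \<one>\<^bsub>A i\<^esub>" using q\<kappa>[OF that(1) x] that(1) by simp
    then show ?thesis using kerq[OF that(1)] group_hom.hom_closed[OF \<kappa>i[OF that(1)] x] by simp
  qed
  have \<kappa>_D: "?DE i #>\<^bsub>E i\<^esub> \<kappa> x i = ?DE i #>\<^bsub>E i\<^esub> \<kappa> y i"
    if "i \<in> I" "x \<in> carrier F" "y \<in> carrier F" "?D #>\<^bsub>F\<^esub> x = ?D #>\<^bsub>F\<^esub> y" for i x y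
  proof (rule group_hom.coset_eq_hom[OF \<kappa>i[OF that(1)] D(1)[OF that(1)] DE[OF that(1)] _ that(2-4)])
    show "(\<lambda>x. \<kappa> x i) ` ?D \<subseteq> ?DE i"
      using \<kappa>_S[OF that(1)]
      by (intro group_hom.hom_iterated_commutator[OF \<kappa>i[OF that(1)]] F.normal_subset[OF R]
          group.normal_subset[OF E[OF that(1)] S[OF that(1)]]) blast
  qed
  have \<mu>_D: "?DP #>\<^bsub>P\<^esub> \<mu> x = ?DP #>\<^bsub>P\<^esub> \<mu> y"
    if "x \<in> carrier F" "y \<in> carrier F" "?D #>\<^bsub>F\<^esub> x = ?D #>\<^bsub>F\<^esub> y" for x y
  proof (rule \<mu>.coset_eq_hom[OF F.normal_iterated_commutator[OF R] P.normal_iterated_commutator[OF H] _ that])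
    show "\<mu> ` ?D \<subseteq> ?DP"
      using R_iff F.normal_subset[OF R]
      by (intro \<mu>.hom_iterated_commutator F.normal_subset[OF R] P.normal_subset[OF H]) blast
  qed
  let ?U = "R \<inter> ?\<Gamma>"
  have Uc: "x \<in> carrier F" if "x \<in> ?U" for x using that F.normal_subset[OF R] by blast
  have U: "subgroup ?U F" using R by (rule F.subgroup_multiplier_numerator)
  define \<Phi> where "\<Phi> x = ((\<lambda>i\<in>I. ?DE i #>\<^bsub>E i\<^esub> \<kappa> x i), ?DP #>\<^bsub>P\<^esub> \<mu> x)" for x
  have \<Phi>_closed: "\<Phi> x \<in> carrier (?MA \<times>\<times> ?MP)" if x: "x \<in> ?U" for x
  proof -
    have xc: "x \<in> carrier F" using Uc[OF x] .
    have "?DE i #>\<^bsub>E i\<^esub> \<kappa> x i \<in> carrier (nilpotent_multiplier c (E i) (S i))" if i: "i \<in> I" for i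
      unfolding group.carrier_nilpotent_multiplier[OF E[OF i]]
      using \<kappa>_S[OF i] group_hom.hom_lower_central[OF \<kappa>i[OF i]] x by blast
    moreover have "finite {i \<in> I. (\<lambda>i\<in>I. ?DE i #>\<^bsub>E i\<^esub> \<kappa> x i) i \<noteq> \<one>\<^bsub>nilpotent_multiplier c (E i) (S i)\<^esub>}"
    proof (rule finite_subset)
      show "finite {i \<in> I. \<kappa> x i \<noteq> \<one>\<^bsub>E i\<^esub>}"
        using \<kappa>.hom_closed[OF xc] by (simp add: carrier_sum_group E)
      have "?DE i #>\<^bsub>E i\<^esub> \<one>\<^bsub>E i\<^esub> = ?DE i" if "i \<in> I" for i
        using group.coset_mult_one[OF E[OF that] group.normal_subset[OF E[OF that] DE[OF that]]] .
      then show "{i \<in> I. (\<lambda>i\<in>I. ?DE i #>\<^bsub>E i\<^esub> \<kappa> x i) i \<noteq> \<one>\<^bsub>nilpotent_multiplier c (E i) (S i)\<^esub>}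
          \<subseteq> {i \<in> I. \<kappa> x i \<noteq> \<one>\<^bsub>E i\<^esub>}"
        by (auto simp: group.one_nilpotent_multiplier[OF E])
    qed
    moreover have "?DP #>\<^bsub>P\<^esub> \<mu> x \<in> carrier ?MP"
      unfolding P.carrier_nilpotent_multiplier
      using x R_iff[OF xc] \<mu>.hom_lower_central by blast
    ultimately show ?thesis
      by (simp add: \<Phi>_def carrier_sum_group)
  qed
  have \<Phi>_mult: "\<Phi> (x \<otimes>\<^bsub>F\<^esub> y) = \<Phi> x \<otimes>\<^bsub>?MA \<times>\<times> ?MP\<^esub> \<Phi> y" if x: "x \<in> ?U" and y: "y \<in> ?U" for x y
  proof -
    have xy: "x \<in> carrier F" "y \<in> carrier F" using Uc x y by auto
    have "?DE i #>\<^bsub>E i\<^esub> \<kappa> (x \<otimes>\<^bsub>F\<^esub> y) i =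
        (?DE i #>\<^bsub>E i\<^esub> \<kappa> x i) \<otimes>\<^bsub>nilpotent_multiplier c (E i) (S i)\<^esub> (?DE i #>\<^bsub>E i\<^esub> \<kappa> y i)"
      if i: "i \<in> I" for i
      using group.mult_nilpotent_multiplier[OF E[OF i] S[OF i]] group_hom.hom_closed[OF \<kappa>i[OF i]]
        group_hom.hom_mult[OF \<kappa>i[OF i]] xy by simp
    moreover have "?DP #>\<^bsub>P\<^esub> \<mu> (x \<otimes>\<^bsub>F\<^esub> y) = (?DP #>\<^bsub>P\<^esub> \<mu> x) \<otimes>\<^bsub>?MP\<^esub> (?DP #>\<^bsub>P\<^esub> \<mu> y)"
      using P.mult_nilpotent_multiplier[OF H] xy by simp
    ultimately show ?thesis
      by (simp add: \<Phi>_def fun_eq_iff)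
  qed
  have \<Phi>_hom: "\<Phi> \<in> hom (F\<lparr>carrier := ?U\<rparr>) (?MA \<times>\<times> ?MP)"
    using \<Phi>_closed \<Phi>_mult by (intro homI) auto
  interpret U: group "F\<lparr>carrier := ?U\<rparr>" using U by (rule F.subgroup_imp_group)
  interpret MA: group ?MA by (rule MA)
  interpret MP: group ?MP by (rule MP)
  have Q: "group (?MA \<times>\<times> ?MP)" using MA MP by (rule DirProd_group)
  interpret \<Phi>: group_hom "F\<lparr>carrier := ?U\<rparr>" "?MA \<times>\<times> ?MP" \<Phi>
    using \<Phi>_hom Q by (simp add: group_hom_def group_hom_axioms_def U.group_axioms)
  have \<Phi>_single: "\<exists>x\<in>?U. \<Phi> x = ((\<lambda>i\<in>I. if i = j then a else \<one>\<^bsub>nilpotent_multiplier c (E i) (S i)\<^esub>), \<one>\<^bsub>?MP\<^esub>)"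
    if j: "j \<in> I" and a: "a \<in> carrier (nilpotent_multiplier c (E j) (S j))" for j a
  proof -
    obtain s where s: "s \<in> S j" "s \<in> iterated_commutator (E j) (carrier (E j)) c" and a_eq: "a = ?DE j #>\<^bsub>E j\<^esub> s"
      using a unfolding group.carrier_nilpotent_multiplier[OF E[OF j]] by blast
    interpret Ej: group "E j" using E[OF j] .
    interpret \<theta>j: group_hom "E j" F "\<theta> j" using \<theta>[OF j] .
    interpret fj: group_hom "A j" P "factor_inclusion j" using factor_inclusion_hom[OF j] unfolding P_def .
    interpret qj: group_hom "E j" "A j" "q j" using q[OF j] .
    have sc: "s \<in> carrier (E j)" using s Ej.normal_subset[OF S[OF j]] by blast
    have qs: "q j s = \<one>\<^bsub>A j\<^esub>" using kerq[OF j sc] s by simp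
    have "\<mu> (\<theta> j s) \<in> H"
      using \<mu>\<theta>[OF j sc] qs P.coset_eq_one_iff[OF H] P.coset_mult_one[OF P.normal_subset[OF H]] sc by simp
    then have xU: "\<theta> j s \<in> ?U"
      using R_iff s(2) sc \<theta>j.hom_lower_central by simp
    have "?DP #>\<^bsub>P\<^esub> (\<mu> \<circ> \<theta> j) s = ?DP #>\<^bsub>P\<^esub> (factor_inclusion j \<circ> q j) s"
      by (rule congruent_homs_on_lower_central[OF group_hom_compose[OF \<theta>j.group_hom_axioms \<mu>]
            group_hom_compose[OF qj.group_hom_axioms fj.group_hom_axioms] H _ s(2)])
        (simp add: \<mu>\<theta>[OF j])
    then have 2: "?DP #>\<^bsub>P\<^esub> \<mu> (\<theta> j s) = \<one>\<^bsub>?MP\<^esub>"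
      using qs P.coset_mult_one[OF P.normal_subset[OF P.normal_iterated_commutator[OF H]]]
      by (simp add: P.one_nilpotent_multiplier)
    have q\<kappa>\<theta>: "q i (\<kappa> (\<theta> j e) i) = single j (q j e) i" if i: "i \<in> I" and e: "e \<in> carrier (E j)" for i e
    proof -
      have "\<mu> (\<theta> j e) \<otimes>\<^bsub>P\<^esub> inv\<^bsub>P\<^esub> factor_inclusion j (q j e) \<in> cartesian_subgroup I A"
        using \<mu>\<theta>[OF j e] P.coset_eq_iff[OF H] HC e by auto
      then have "natural_map I A (\<mu> (\<theta> j e)) \<otimes>\<^bsub>sum_group I A\<^esub> inv\<^bsub>sum_group I A\<^esub> natural_map I A (factor_inclusion j (q j e))
          = \<one>\<^bsub>sum_group I A\<^esub>"
        using e by (simp add: cartesian_subgroup_def kernel_def del: one_sum_group mult_sum_group)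
      then have "natural_map I A (\<mu> (\<theta> j e)) = natural_map I A (factor_inclusion j (q j e))"
        using e \<nu>.H.inv_equality \<nu>.H.inv_inv \<nu>.hom_closed \<mu>.hom_closed \<theta>j.hom_closed fj.hom_closed qj.hom_closed
        by (metis \<nu>.H.inv_closed)
      then show ?thesis
        using q\<kappa>[OF i] e natural_map_factor_inclusion[OF j] by simp
    qed
    have 1: "?DE i #>\<^bsub>E i\<^esub> \<kappa> (\<theta> j s) i = (if i = j then a else \<one>\<^bsub>nilpotent_multiplier c (E i) (S i)\<^esub>)"
      if i: "i \<in> I" for i
    proof -
      interpret Ei: group "E i" using E[OF i] .
      interpret qi: group_hom "E i" "A i" "q i" using q[OF i] .
      interpret \<kappa>\<theta>: group_hom "E j" "E i" "(\<lambda>x. \<kappa> x i) \<circ> \<theta> j"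
        using group_hom_compose[OF \<theta>[OF j] \<kappa>i[OF i]] .
      show ?thesis
      proof (cases "i = j")
        case True
        have "S i #>\<^bsub>E i\<^esub> ((\<lambda>x. \<kappa> x i) \<circ> \<theta> j) e = S i #>\<^bsub>E i\<^esub> e" if e: "e \<in> carrier (E j)" for e
        proof -
          have ee: "e \<in> carrier (E i)" using e True by simp
          have "q i (\<kappa> (\<theta> j e) i) = q i e" using q\<kappa>\<theta>[OF i e] True i by (simp add: single_def)
          then have "q i (\<kappa> (\<theta> j e) i \<otimes>\<^bsub>E i\<^esub> inv\<^bsub>E i\<^esub> e) = \<one>\<^bsub>A i\<^esub>"
            using \<kappa>\<theta>.hom_closed[OF e] ee by simp
          moreover have "\<kappa> (\<theta> j e) i \<otimes>\<^bsub>E i\<^esub> inv\<^bsub>E i\<^esub> e \<in> carrier (E i)"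
            using \<kappa>\<theta>.hom_closed[OF e] ee by simp
          ultimately have "\<kappa> (\<theta> j e) i \<otimes>\<^bsub>E i\<^esub> inv\<^bsub>E i\<^esub> e \<in> S i" using kerq[OF i] by blast
          then show ?thesis
            using Ei.coset_eq_iff[OF S[OF i]] \<kappa>\<theta>.hom_closed[OF e] ee by simp
        qed
        moreover have "group_hom (E j) (E i) (\<lambda>x. x)"
          using True by (simp add: group_hom_def group_hom_axioms_def hom_def Ei.group_axioms)
        ultimately have "?DE i #>\<^bsub>E i\<^esub> ((\<lambda>x. \<kappa> x i) \<circ> \<theta> j) s = ?DE i #>\<^bsub>E i\<^esub> s"
          using congruent_homs_on_lower_central[OF \<kappa>\<theta>.group_hom_axioms _ S[OF i] _ s(2)] by blast
        then show ?thesis using True a_eq by simp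
      next
        case False
        have triv: "group_hom (E j) (E i) (\<lambda>x. \<one>\<^bsub>E i\<^esub>)"
          by (simp add: group_hom_def group_hom_axioms_def hom_def Ei.group_axioms Ej.group_axioms)
        have "S i #>\<^bsub>E i\<^esub> ((\<lambda>x. \<kappa> x i) \<circ> \<theta> j) e = S i #>\<^bsub>E i\<^esub> \<one>\<^bsub>E i\<^esub>" if e: "e \<in> carrier (E j)" for e
        proof -
          have "q i (\<kappa> (\<theta> j e) i) = \<one>\<^bsub>A i\<^esub>" using q\<kappa>\<theta>[OF i e] False i by (simp add: single_def)
          then show ?thesis
            using kerq[OF i] Ei.coset_eq_iff[OF S[OF i]] \<kappa>\<theta>.hom_closed[OF e] by simp
        qed
        then have "?DE i #>\<^bsub>E i\<^esub> ((\<lambda>x. \<kappa> x i) \<circ> \<theta> j) s = ?DE i #>\<^bsub>E i\<^esub> \<one>\<^bsub>E i\<^esub>"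
          using congruent_homs_on_lower_central[OF \<kappa>\<theta>.group_hom_axioms triv S[OF i] _ s(2)] by blast
        then show ?thesis
          using False Ei.coset_mult_one[OF Ei.normal_subset[OF DE[OF i]]] by (simp add: Ei.one_nilpotent_multiplier)
      qed
    qed
    have "\<Phi> (\<theta> j s) = ((\<lambda>i\<in>I. if i = j then a else \<one>\<^bsub>nilpotent_multiplier c (E i) (S i)\<^esub>), \<one>\<^bsub>?MP\<^esub>)"
      unfolding \<Phi>_def 2 using 1 by (auto intro: restrict_ext)
    then show ?thesis using xU by blast
  qed
  \<comment> \<open>The first factor is generated by the elements supported at one index.\<close>
  have \<Phi>_left: "\<exists>x\<in>?U. \<Phi> x = (m, \<one>\<^bsub>?MP\<^esub>)"
    if "finite J" "m \<in> carrier ?MA" "{i \<in> I. m i \<noteq> \<one>\<^bsub>nilpotent_multiplier c (E i) (S i)\<^esub>} \<subseteq> J" for J m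
    using that
  proof (induction J arbitrary: m)
    case empty
    have "m = \<one>\<^bsub>?MA\<^esub>"
      using empty by (auto simp: carrier_sum_group PiE_iff extensional_def fun_eq_iff)
    then have "\<Phi> \<one>\<^bsub>F\<^esub> = (m, \<one>\<^bsub>?MP\<^esub>)" using \<Phi>.hom_one by simp
    moreover have "\<one>\<^bsub>F\<^esub> \<in> ?U" using U by (rule subgroup.one_closed)
    ultimately show ?case by blast
  next
    case (insert j J)
    let ?M = "\<lambda>i. nilpotent_multiplier c (E i) (S i)"
    show ?case
    proof (cases "j \<in> I")
      case False
      then have "{i \<in> I. m i \<noteq> \<one>\<^bsub>?M i\<^esub>} \<subseteq> J" using insert.prems(2) by blast
      with insert.prems(1) show ?thesis by (rule insert.IH)
    next
      case True
      have mi: "m i \<in> carrier (?M i)" if "i \<in> I" for i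
        using insert.prems(1) that by (auto simp: carrier_sum_group)
      obtain x where x: "x \<in> ?U" "\<Phi> x = ((\<lambda>i\<in>I. if i = j then m j else \<one>\<^bsub>?M i\<^esub>), \<one>\<^bsub>?MP\<^esub>)"
        using \<Phi>_single[OF True mi[OF True]] by blast
      let ?m' = "\<lambda>i\<in>I. if i = j then \<one>\<^bsub>?M i\<^esub> else m i"
      have supp: "{i \<in> I. ?m' i \<noteq> \<one>\<^bsub>?M i\<^esub>} \<subseteq> J" using insert.prems(2) by auto
      have "?m' \<in> carrier ?MA"
        using mi finite_subset[OF supp insert.hyps(1)] by (simp add: carrier_sum_group group.is_monoid)
      then obtain y where y: "y \<in> ?U" "\<Phi> y = (?m', \<one>\<^bsub>?MP\<^esub>)" using insert.IH[OF _ supp] by blast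
      have "(\<lambda>i\<in>I. if i = j then m j else \<one>\<^bsub>?M i\<^esub>) \<otimes>\<^bsub>?MA\<^esub> ?m' = m"
      proof
        fix i
        show "((\<lambda>i\<in>I. if i = j then m j else \<one>\<^bsub>?M i\<^esub>) \<otimes>\<^bsub>?MA\<^esub> ?m') i = m i"
        proof (cases "i \<in> I")
          case i: True
          then interpret Mi: group "?M i" by simp
          show ?thesis using i mi[OF i] Mi.r_one[OF mi[OF i]] by (cases "i = j") simp_all
        next
          case False
          then show ?thesis using insert.prems(1) by (auto simp: carrier_sum_group PiE_iff extensional_def)
        qed
      qed
      then have "\<Phi> (x \<otimes>\<^bsub>F\<^esub> y) = (m, \<one>\<^bsub>?MP\<^esub>)"
        using x y by (simp add: \<Phi>_mult del: mult_sum_group)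
      moreover have "x \<otimes>\<^bsub>F\<^esub> y \<in> ?U" using U x(1) y(1) by (rule subgroup.m_closed)
      ultimately show ?thesis by blast
    qed
  qed
  have surj: "\<exists>x\<in>?U. \<Phi> x = (m, n)" if m: "m \<in> carrier ?MA" and n: "n \<in> carrier ?MP" for m n
  proof -
    obtain g where g: "g \<in> H" "g \<in> iterated_commutator P (carrier P) c" and n_eq: "n = ?DP #>\<^bsub>P\<^esub> g"
      using n unfolding P.carrier_nilpotent_multiplier by blast
    have gc: "g \<in> carrier P" using g P.normal_subset[OF H] by blast
    have "\<exists>x\<in>carrier F. H #>\<^bsub>P\<^esub> \<mu> x = H #>\<^bsub>P\<^esub> y" if "y \<in> carrier P" for y
    proof -
      have "H #>\<^bsub>P\<^esub> y \<in> \<phi> ` carrier F" using \<phi>(2) qP.hom_closed[OF that] by blast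
      then show ?thesis using \<mu>\<phi> by force
    qed
    then obtain x where x: "x \<in> ?\<Gamma>" "?DP #>\<^bsub>P\<^esub> \<mu> x = ?DP #>\<^bsub>P\<^esub> g"
      using lower_central_lift[OF \<mu> H _ g(2)] by blast
    have xc: "x \<in> carrier F" using x(1) F.normal_subset[OF F.normal_lower_central] by blast
    have "\<mu> x \<otimes>\<^bsub>P\<^esub> inv\<^bsub>P\<^esub> g \<in> ?DP"
      using x(2) P.coset_eq_iff[OF P.normal_iterated_commutator[OF H]] xc gc by simp
    then have "\<mu> x \<otimes>\<^bsub>P\<^esub> inv\<^bsub>P\<^esub> g \<in> H" using P.iterated_commutator_subset[OF H] by blast
    then have "\<mu> x \<otimes>\<^bsub>P\<^esub> inv\<^bsub>P\<^esub> g \<otimes>\<^bsub>P\<^esub> g \<in> H"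
      using g(1) by (rule subgroup.m_closed[OF normal_imp_subgroup[OF H]])
    then have "x \<in> R" using R_iff[OF xc] xc gc by (simp add: P.m_assoc)
    then have xU: "x \<in> ?U" using x(1) by blast
    define m0 where "m0 = fst (\<Phi> x)"
    have \<Phi>x: "\<Phi> x = (m0, n)" using x(2) n_eq by (simp add: \<Phi>_def m0_def)
    have m0: "m0 \<in> carrier ?MA" using \<Phi>_closed[OF xU] \<Phi>x by simp
    have m1: "m \<otimes>\<^bsub>?MA\<^esub> inv\<^bsub>?MA\<^esub> m0 \<in> carrier ?MA" using m m0 by (intro MA.m_closed MA.inv_closed)
    then have "finite {i \<in> I. (m \<otimes>\<^bsub>?MA\<^esub> inv\<^bsub>?MA\<^esub> m0) i \<noteq> \<one>\<^bsub>nilpotent_multiplier c (E i) (S i)\<^esub>}"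
      by (simp add: carrier_sum_group del: mult_sum_group inv_sum_group)
    then obtain y where y: "y \<in> ?U" "\<Phi> y = (m \<otimes>\<^bsub>?MA\<^esub> inv\<^bsub>?MA\<^esub> m0, \<one>\<^bsub>?MP\<^esub>)"
      using \<Phi>_left[OF _ m1 subset_refl] by blast
    have "m \<otimes>\<^bsub>?MA\<^esub> inv\<^bsub>?MA\<^esub> m0 \<otimes>\<^bsub>?MA\<^esub> m0 = m"
      using m m0 by (simp add: MA.m_assoc del: mult_sum_group inv_sum_group one_sum_group)
    then have "\<Phi> (y \<otimes>\<^bsub>F\<^esub> x) = (m, n)"
      using y xU n by (simp add: \<Phi>_mult \<Phi>x del: mult_sum_group inv_sum_group)
    moreover have "y \<otimes>\<^bsub>F\<^esub> x \<in> ?U" using U y(1) xU by (rule subgroup.m_closed)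
    ultimately show ?thesis by blast
  qed
  have NU: "?D \<lhd> F\<lparr>carrier := ?U\<rparr>" using R by (rule F.normal_multiplier_denominator)
  have \<Phi>_D: "\<Phi> x = \<Phi> y" if "x \<in> ?U" "y \<in> ?U" "?D #>\<^bsub>F\<^esub> x = ?D #>\<^bsub>F\<^esub> y" for x y
  proof -
    have "(\<lambda>i\<in>I. ?DE i #>\<^bsub>E i\<^esub> \<kappa> x i) = (\<lambda>i\<in>I. ?DE i #>\<^bsub>E i\<^esub> \<kappa> y i)"
      by (intro restrict_ext \<kappa>_D Uc that)
    moreover have "?DP #>\<^bsub>P\<^esub> \<mu> x = ?DP #>\<^bsub>P\<^esub> \<mu> y"
      by (intro \<mu>_D Uc that)
    ultimately show ?thesis by (simp only: \<Phi>_def)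
  qed
  have cU: "carrier (F\<lparr>carrier := ?U\<rparr>) = ?U" by simp
  have wd: "\<Phi> x = \<Phi> y"
    if "x \<in> carrier (F\<lparr>carrier := ?U\<rparr>)" "y \<in> carrier (F\<lparr>carrier := ?U\<rparr>)"
      "?D #>\<^bsub>F\<lparr>carrier := ?U\<rparr>\<^esub> x = ?D #>\<^bsub>F\<lparr>carrier := ?U\<rparr>\<^esub> y" for x y
    using that unfolding r_coset_consistent cU by (rule \<Phi>_D)
  obtain g where g: "g \<in> hom ((F\<lparr>carrier := ?U\<rparr>) Mod ?D) (?MA \<times>\<times> ?MP)"
    and "\<And>x. x \<in> carrier (F\<lparr>carrier := ?U\<rparr>) \<Longrightarrow> g (?D #>\<^bsub>F\<lparr>carrier := ?U\<rparr>\<^esub> x) = \<Phi> x"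
    by (rule FactGroup_universal[OF \<Phi>_hom NU]; (rule wd | rule that); assumption)
  then have g\<Phi>: "\<And>x. x \<in> ?U \<Longrightarrow> g (?D #>\<^bsub>F\<^esub> x) = \<Phi> x"
    by (simp only: r_coset_consistent cU)
  have "carrier (?MA \<times>\<times> ?MP) \<subseteq> g ` carrier (nilpotent_multiplier c F R)"
    unfolding F.carrier_nilpotent_multiplier
  proof
    fix z assume z: "z \<in> carrier (?MA \<times>\<times> ?MP)"
    obtain m n where mn: "z = (m, n)" by (rule prod.exhaust)
    have "m \<in> carrier ?MA" "n \<in> carrier ?MP" using z mn by simp_all
    then obtain x where x: "x \<in> ?U" "\<Phi> x = z" using surj mn by blast
    have "z = g (?D #>\<^bsub>F\<^esub> x)" using x g\<Phi> by simp
    also have "\<dots> \<in> g ` (\<lambda>x. ?D #>\<^bsub>F\<^esub> x) ` ?U" using x(1) by (intro imageI)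
    finally show "z \<in> g ` (\<lambda>x. ?D #>\<^bsub>F\<^esub> x) ` ?U" .
  qed
  then have "g \<in> epi (nilpotent_multiplier c F R) (?MA \<times>\<times> ?MP)"
    using g unfolding F.nilpotent_multiplier_eq[symmetric] by (simp only: epi_iff_subset)
  then show ?thesis by (intro exI[of _ g])
qed

theorem theorem2p9:
  fixes I :: "'i set"
    and A :: "'i \<Rightarrow> ('a, 'm) monoid_scheme"
    and c :: nat
    and V :: "law set"
    and E :: "'i \<Rightarrow> ('e, 'k) monoid_scheme" and S :: "'i \<Rightarrow> 'e set"
    and F :: "('f, 'l) monoid_scheme" and R :: "'f set"
  defines "P \<equiv> free_product I A"
    and "G \<equiv> verbal_product V I A"
    and "H\<^sub>v \<equiv> verbal_subgroup (free_product I A) V \<inter> cartesian_subgroup I A"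
    and "H\<^sub>c \<equiv> lower_central (free_product I A) (c + 1) \<inter> cartesian_subgroup I A"
    and "M \<equiv> nilpotent_multiplier c F R"
    and "MA \<equiv> sum_group I (\<lambda>i. nilpotent_multiplier c (E i) (S i))"
  assumes "\<And>i. i \<in> I \<Longrightarrow> group (A i)"
    and "c \<ge> 1"
    and "\<And>i. i \<in> I \<Longrightarrow> free_presentation (E i) (S i) (A i)"
    and "free_presentation F R G"
  shows "((nilpotent_variety c :: nat monoid set) \<subseteq> variety V \<longrightarrow>
            (let Q = MA \<times>\<times> ((P\<lparr>carrier := H\<^sub>v\<rparr>) Mod iterated_commutator P H\<^sub>v c) in
             (\<exists>h. h \<in> epi M Q) \<and>
             (finite (carrier G) \<longrightarrow> (\<exists>K. subgroup K M \<and> Q \<cong> M\<lparr>carrier := K\<rparr>)))) \<and>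
         ((variety V :: nat monoid set) \<subseteq> nilpotent_variety c \<longrightarrow>
            (let Q = MA \<times>\<times> ((P\<lparr>carrier := H\<^sub>c\<rparr>) Mod iterated_commutator P H\<^sub>v c) in
             (\<exists>h. h \<in> epi M Q) \<and>
             (finite (carrier G) \<longrightarrow> (\<exists>K. subgroup K M \<and> Q \<cong> M\<lparr>carrier := K\<rparr>))))"
proof -
  interpret group_family I A by (intro group_family.intro assms(7))
  interpret P: group P unfolding P_def by (rule group_free_product)
  interpret \<nu>: group_hom P "sum_group I A" "natural_map I A"
    using natural_map_hom unfolding P_def .
  have H: "H\<^sub>v \<lhd> P"
    unfolding H\<^sub>v_def cartesian_subgroup_def P_def[symmetric]
    by (intro P.normal_subgroup_intersect P.normal_verbal \<nu>.normal_kernel)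
  have HC: "H\<^sub>v \<subseteq> cartesian_subgroup I A" unfolding H\<^sub>v_def by (rule Int_lower2)
  have G: "G = P Mod H\<^sub>v" unfolding G_def verbal_product_def P_def H\<^sub>v_def ..
  have FR: "free_presentation F R (P Mod H\<^sub>v)" using assms(10) unfolding G .
  let ?Q = "MA \<times>\<times> nilpotent_multiplier c P H\<^sub>v"
  have epi: "\<exists>h. h \<in> epi M ?Q"
    unfolding M_def MA_def P_def
    by (rule nilpotent_multiplier_epi[OF H[unfolded P_def] HC assms(9) FR[unfolded P_def]])
  have PG: "group (P Mod H\<^sub>v)" using H by (rule normal.factorgroup_is_group)
  interpret F: group F using free_presentation_epi(1)[OF FR PG] .
  have R: "R \<lhd> F" using free_presentation_epi(2)[OF FR PG] .
  interpret M: comm_group M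
    unfolding M_def using R assms(8) by (rule F.comm_group_nilpotent_multiplier)
  have "group (nilpotent_multiplier c (E i) (S i))" if "i \<in> I" for i
    using free_presentation_epi(1,2)[OF assms(9)[OF that] assms(7)[OF that]]
    by (rule group.group_nilpotent_multiplier)
  then have Q: "group ?Q"
    unfolding MA_def by (intro DirProd_group sum_group P.group_nilpotent_multiplier H)
  have embed: "\<exists>K. subgroup K M \<and> ?Q \<cong> M\<lparr>carrier := K\<rparr>" if "finite (carrier G)"
  proof -
    have "F Mod R \<cong> P Mod H\<^sub>v" using FR by (simp add: free_presentation_def)
    then have "finite (carrier (F Mod R))" using that iso_finite unfolding G by blast
    then have "finite (carrier M)"
      unfolding M_def by (rule F.finite_nilpotent_multiplier[OF R])
    then show ?thesis using epi Q M.epi_image_iso_subgroup by blast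
  qed
  have nm: "nilpotent_multiplier c P H\<^sub>v = (P\<lparr>carrier := X\<rparr>) Mod iterated_commutator P H\<^sub>v c"
    if "H\<^sub>v \<inter> iterated_commutator P (carrier P) c = X" for X
    using that by (simp add: P.nilpotent_multiplier_eq)
  \<comment> \<open>In either case \<open>X\<close> is the numerator that the statement prescribes.\<close>
  have *: "(let Q = MA \<times>\<times> ((P\<lparr>carrier := X\<rparr>) Mod iterated_commutator P H\<^sub>v c) in
             (\<exists>h. h \<in> epi M Q) \<and>
             (finite (carrier G) \<longrightarrow> (\<exists>K. subgroup K M \<and> Q \<cong> M\<lparr>carrier := K\<rparr>)))"
    if "H\<^sub>v \<inter> iterated_commutator P (carrier P) c = X" for X
    using epi embed unfolding Let_def nm[OF that] by blast
  have "H\<^sub>v \<inter> iterated_commutator P (carrier P) c = H\<^sub>v"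
    if "(nilpotent_variety c :: nat monoid set) \<subseteq> variety V"
    using P.verbal_subset_lower_central[OF that] unfolding H\<^sub>v_def P_def by blast
  moreover have "H\<^sub>v \<inter> iterated_commutator P (carrier P) c = H\<^sub>c"
    if "(variety V :: nat monoid set) \<subseteq> nilpotent_variety c"
    using P.lower_central_subset_verbal[OF that]
    unfolding H\<^sub>v_def H\<^sub>c_def P_def lower_central_def add_diff_cancel_right' by blast
  ultimately show ?thesis using * by blast
qed

end
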